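(* Let $(G,\mu)$ be a measured group with $G$ finitely generated and $\mu$ symmetric, and let $\rho$ be a word-norm on $G$. Suppose that $\rho$ is $\mu$-integrable, i.e. $\sum_{s\in G}\rho(s)\,\mu(s)<\infty$. Then $(G,\mu)$ is Liouville if and only if $\ell_\rho(\mu)=0$.
   Context: A measured group is a pair $(G,\mu)$, where $G$ is a countable group and $\mu$ is a probability measure on $G$ whose support generates $G$ as a semi-group. The measure $\mu$ is symmetric if $\mu(s^{-1})=\mu(s)$ for all $s\in G$. Write $\mu^{*n}$ for the $n$-fold convolution power: $\mu^{*n}(s)=\sum \mu(s_1)\cdots\mu(s_n)$, the sum being over all $(s_1,\ldots,s_n)\in G^n$ with $s_1\cdots s_n=s$. A real-valued function $u$ on $G$ is $\mu$-harmonic if $\sum_{s} u(gs)\,\mu(s)=u(g)$ for all $g\in G$. $(G,\mu)$ is Liouville if every bounded real-valued $\mu$-harmonic function on $G$ is constant. If $S\subset G$ is a finite generating set with $S^{-1}=S$, the word-norm associated to $S$ is $\rho_S(e)=0$ and $\rho_S(s)=\inf\{n\ge 1 : s\in S^n\}$ for $s\neq e$, where $S^n$ is the set of products of $n$ elements of $S$. A word-norm on $G$ is a function of the form $\rho_S$ for such an $S$. The drift is $\ell_\rho(\mu)=\lim_{n\to\infty}\frac1n\sum_{s\in G}\rho(s)\,\mu^{*n}(s)$; the limit exists by sub-additivity and is finite if $\rho$ is $\mu$-integrable. *)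

theory Defs
  imports "HOL-Algebra.Generated_Groups" "HOL-Probability.Probability"
begin

inductive_set semigroup_generate :: "('a, 'b) monoid_scheme \<Rightarrow> 'a set \<Rightarrow> 'a set"
  for G and H where
  incl: "h \<in> H \<Longrightarrow> h \<in> semigroup_generate G H"
| mult: "g \<in> semigroup_generate G H \<Longrightarrow> h \<in> semigroup_generate G H
          \<Longrightarrow> g \<otimes>\<^bsub>G\<^esub> h \<in> semigroup_generate G H"

text \<open>
  A probability measure on the countable group \<open>G\<close> is a \<open>pmf\<close> on the ambient type whose support
  lies in the carrier.
\<close>

locale measured_group = group G for G :: "('a, 'b) monoid_scheme" (structure) +
  fixes \<mu> :: "'a pmf"
  assumes countable_carrier: "countable (carrier G)"
    and support_subset: "set_pmf \<mu> \<subseteq> carrier G"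
    and support_generates: "semigroup_generate G (set_pmf \<mu>) = carrier G"

definition symmetric_measure :: "('a, 'b) monoid_scheme \<Rightarrow> 'a pmf \<Rightarrow> bool" where
  "symmetric_measure G \<mu> \<longleftrightarrow> (\<forall>s\<in>carrier G. pmf \<mu> (inv\<^bsub>G\<^esub> s) = pmf \<mu> s)"

definition finitely_generated :: "('a, 'b) monoid_scheme \<Rightarrow> bool" where
  "finitely_generated G \<longleftrightarrow> (\<exists>S. finite S \<and> S \<subseteq> carrier G \<and> generate G S = carrier G)"

definition list_mult :: "('a, 'b) monoid_scheme \<Rightarrow> 'a list \<Rightarrow> 'a" where
  "list_mult G xs = foldr (\<lambda>x y. x \<otimes>\<^bsub>G\<^esub> y) xs \<one>\<^bsub>G\<^esub>"

text \<open>Tuples in \<open>G\<^sup>n\<close> are lists of length \<open>n\<close> over the carrier.\<close>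

definition conv_power :: "('a, 'b) monoid_scheme \<Rightarrow> 'a pmf \<Rightarrow> nat \<Rightarrow> 'a \<Rightarrow> real" where
  "conv_power G \<mu> n s =
     (\<Sum>\<^sub>\<infinity>xs\<in>{xs. length xs = n \<and> set xs \<subseteq> carrier G \<and> list_mult G xs = s}.
        prod_list (map (pmf \<mu>) xs))"

text \<open>\<open>has_sum\<close> makes convergence of the sum part of harmonicity; for bounded \<open>u\<close> it is automatic.\<close>

definition harmonic :: "('a, 'b) monoid_scheme \<Rightarrow> 'a pmf \<Rightarrow> ('a \<Rightarrow> real) \<Rightarrow> bool" where
  "harmonic G \<mu> u \<longleftrightarrow>
     (\<forall>g\<in>carrier G. ((\<lambda>s. u (g \<otimes>\<^bsub>G\<^esub> s) * pmf \<mu> s) has_sum u g) (carrier G))"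

definition liouville :: "('a, 'b) monoid_scheme \<Rightarrow> 'a pmf \<Rightarrow> bool" where
  "liouville G \<mu> \<longleftrightarrow>
     (\<forall>u. bounded (u ` carrier G) \<and> harmonic G \<mu> u \<longrightarrow> (\<exists>c. \<forall>g\<in>carrier G. u g = c))"

definition set_power :: "('a, 'b) monoid_scheme \<Rightarrow> 'a set \<Rightarrow> nat \<Rightarrow> 'a set" where
  "set_power G S n = {list_mult G xs | xs. length xs = n \<and> set xs \<subseteq> S}"

definition word_norm_of :: "('a, 'b) monoid_scheme \<Rightarrow> 'a set \<Rightarrow> 'a \<Rightarrow> nat" where
  "word_norm_of G S s = (if s = \<one>\<^bsub>G\<^esub> then 0 else Inf {n. n \<ge> 1 \<and> s \<in> set_power G S n})"

definition word_norm :: "('a, 'b) monoid_scheme \<Rightarrow> ('a \<Rightarrow> real) \<Rightarrow> bool" where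
  "word_norm G \<rho> \<longleftrightarrow>
     (\<exists>S. finite S \<and> S \<subseteq> carrier G \<and> generate G S = carrier G \<and> m_inv G ` S = S \<and>
          (\<forall>s\<in>carrier G. \<rho> s = real (word_norm_of G S s)))"

definition measure_integrable ::
    "('a, 'b) monoid_scheme \<Rightarrow> 'a pmf \<Rightarrow> ('a \<Rightarrow> real) \<Rightarrow> bool" where
  "measure_integrable G \<mu> \<rho> \<longleftrightarrow> (\<lambda>s. \<rho> s * pmf \<mu> s) summable_on carrier G"

text \<open>
  Under \<open>\<mu>\<close>-integrability of a word-norm all sums and the limit exist.  Without integrability the
  drift is infinite in the mathematics, while here divergent sums have the default value \<open>0\<close>.
\<close>

definition drift :: "('a, 'b) monoid_scheme \<Rightarrow> ('a \<Rightarrow> real) \<Rightarrow> 'a pmf \<Rightarrow> real" where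
  "drift G \<rho> \<mu> = lim (\<lambda>n. (1 / real n) * (\<Sum>\<^sub>\<infinity>s\<in>carrier G. \<rho> s * conv_power G \<mu> n s))"

end

theory Submission
  imports Defs "HOL-Complex_Analysis.Great_Picard"
begin

text \<open>
  Let \<open>X\<^sub>n\<close> be the walk at time \<open>n\<close>. If \<open>(G, \<mu>)\<close> is Liouville, take a subsequential pointwise limit
  \<open>\<phi>\<close> of the Cesaro means of \<open>g \<mapsto> E (\<rho> (g X\<^sub>n) - \<rho> X\<^sub>n)\<close>. For fixed \<open>g\<close> the function
  \<open>h \<mapsto> \<phi> (g h) - \<phi> h\<close> is bounded and harmonic, hence constant, so \<open>\<phi>\<close> is a homomorphism to the
  reals. Its mean under \<open>\<mu>\<close> is the drift, and it vanishes because \<open>\<mu>\<close> is symmetric.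

  Conversely, comparing with the law of a random word of geometric length bounds the entropy \<open>H\<^sub>n\<close> of
  \<open>X\<^sub>n\<close> by a linear function of \<open>E (\<rho> X\<^sub>n)\<close>, so zero drift makes \<open>H\<^sub>n / n\<close> tend to zero. The
  increment \<open>H\<^sub>n\<^sub>+\<^sub>1 - H\<^sub>n\<close> is the mutual information of the first step and \<open>X\<^sub>n\<^sub>+\<^sub>1\<close>; by the Gibbs
  variational inequality it controls the \<open>\<mu>\<close>-mean of \<open>(u (g x) - u g)\<^sup>2\<close> for every bounded harmonic
  \<open>u\<close>, which is therefore zero.
\<close>

section \<open>Expectations of discrete laws\<close>

text \<open>For \<open>x = - y < 0\<close> the bound comes from \<open>exp y \<ge> 1 + y\<close> and
  \<open>(1 - y + y\<^sup>2) * (1 + y) = 1 + y ^ 3\<close>. It expands the exponential moment in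
  \<open>entropy_increment_ge\<close> to second order.\<close>

lemma exp_le_quadratic:
  fixes x :: real
  assumes "\<bar>x\<bar> \<le> 1"
  shows "exp x \<le> 1 + x + x\<^sup>2"
proof (cases "x \<ge> 0")
  case True
  then show ?thesis using assms exp_bound[of x] by simp
next
  case False
  define y where "y = - x"
  have y: "0 < y" "y \<le> 1" using False assms by (auto simp: y_def)
  have "1 + y \<le> exp y" by (rule exp_ge_add_one_self)
  then have "exp x \<le> 1 / (1 + y)"
    using y by (simp add: y_def exp_minus field_simps)
  also have "\<dots> \<le> 1 - y + y\<^sup>2"
  proof -
    have "(1 - y + y\<^sup>2) * (1 + y) = 1 + y ^ 3"
      by (simp add: algebra_simps power2_eq_square power3_eq_cube)
    then show ?thesis using y by (simp add: pos_divide_le_eq)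
  qed
  finally show ?thesis by (simp add: y_def)
qed

text \<open>The bridge from the sums over the carrier in the definitions to integrals against a
  \<open>pmf\<close>: terms off the support vanish, and for real families summability and absolute
  summability agree.\<close>

lemma integrable_pmf_iff_summable_on:
  fixes f :: "'a \<Rightarrow> real"
  assumes "set_pmf p \<subseteq> A"
  shows "integrable (measure_pmf p) f \<longleftrightarrow> (\<lambda>x. f x * pmf p x) summable_on A"
proof -
  have "integrable (measure_pmf p) f \<longleftrightarrow> integrable (count_space UNIV) (\<lambda>x. pmf p x *\<^sub>R f x)"
    unfolding measure_pmf_eq_density by (rule integrable_density) auto
  also have "\<dots> \<longleftrightarrow> Infinite_Set_Sum.abs_summable_on (\<lambda>x. f x * pmf p x) UNIV"
    by (simp add: Infinite_Set_Sum.abs_summable_on_def mult.commute)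
  also have "\<dots> \<longleftrightarrow> Infinite_Set_Sum.abs_summable_on (\<lambda>x. f x * pmf p x) A"
    using assms by (intro abs_summable_on_cong_neutral) (auto simp: set_pmf_iff)
  also have "\<dots> \<longleftrightarrow> (\<lambda>x. f x * pmf p x) summable_on A"
    by (simp only: abs_summable_equivalent[symmetric] summable_on_iff_abs_summable_on_real[symmetric])
  finally show ?thesis .
qed

lemma has_sum_expectation_pmf:
  fixes f :: "'a \<Rightarrow> real"
  assumes "set_pmf p \<subseteq> A" and "integrable (measure_pmf p) f"
  shows "((\<lambda>x. f x * pmf p x) has_sum measure_pmf.expectation p f) A"
proof -
  have s: "(\<lambda>x. f x * pmf p x) summable_on A"
    using assms integrable_pmf_iff_summable_on by blast
  have s': "(\<lambda>x. f x * pmf p x) summable_on UNIV"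
    using assms integrable_pmf_iff_summable_on[of p UNIV f] by simp
  have "measure_pmf.expectation p f = infsetsum (\<lambda>x. f x * pmf p x) UNIV"
    by (subst pmf_expectation_eq_infsetsum) (subst mult.commute, rule refl)
  also have "\<dots> = infsum (\<lambda>x. f x * pmf p x) UNIV"
    using s' by (intro infsetsum_infsum abs_summable_equivalent[THEN iffD1]
        summable_on_iff_abs_summable_on_real[THEN iffD1])
  also have "\<dots> = infsum (\<lambda>x. f x * pmf p x) A"
    using assms(1) by (intro infsum_cong_neutral) (auto simp: set_pmf_iff)
  finally show ?thesis using s by simp
qed

lemma expectation_pair_pmf:
  fixes f :: "'a \<times> 'b \<Rightarrow> real"
  assumes "integrable (measure_pmf (pair_pmf p q)) f"
  shows "measure_pmf.expectation (pair_pmf p q) f =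
    measure_pmf.expectation p (\<lambda>x. measure_pmf.expectation q (\<lambda>y. f (x, y)))"
proof -
  let ?F = "\<lambda>(x, y). f (x, y) * (pmf p x * pmf q y)"
  have F: "(\<lambda>z. f z * pmf (pair_pmf p q) z) = ?F"
    by (auto simp: pmf_pair fun_eq_iff)
  have s: "?F summable_on (UNIV \<times> UNIV)"
    using assms integrable_pmf_iff_summable_on[of "pair_pmf p q" UNIV f] F by simp
  let ?E = "\<lambda>x. measure_pmf.expectation q (\<lambda>y. f (x, y))"
  have inner: "infsum (\<lambda>y. f (x, y) * (pmf p x * pmf q y)) UNIV = ?E x * pmf p x" for x
  \<comment> \<open>If \<open>pmf p x = 0\<close>, the slice at \<open>x\<close> need not be
    integrable, but the factor makes both sides zero.\<close>
  proof (cases "pmf p x = 0")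
    case False
    have "(\<lambda>y. f (x, y) * (pmf p x * pmf q y)) summable_on UNIV"
      using summable_on_SigmaD1[of "\<lambda>x y. f (x, y) * (pmf p x * pmf q y)" UNIV "\<lambda>_. UNIV" x] s
      by simp
    then have "(\<lambda>y. (1 / pmf p x) * (f (x, y) * (pmf p x * pmf q y))) summable_on UNIV"
      by (rule summable_on_cmult_right)
    then have "(\<lambda>y. f (x, y) * pmf q y) summable_on UNIV"
      using False by simp
    then have "integrable (measure_pmf q) (\<lambda>y. f (x, y))"
      using integrable_pmf_iff_summable_on[of q UNIV "\<lambda>y. f (x, y)"] by simp
    then have "((\<lambda>y. f (x, y) * pmf q y * pmf p x) has_sum ?E x * pmf p x) UNIV"
      by (intro has_sum_cmult_left has_sum_expectation_pmf) auto
    then show ?thesis by (simp add: infsumI mult_ac)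
  qed simp
  have "(\<lambda>x. ?E x * pmf p x) summable_on UNIV"
    using summable_on_Sigma_banach[of "\<lambda>x y. f (x, y) * (pmf p x * pmf q y)" UNIV "\<lambda>_. UNIV"] s
    by (simp add: inner)
  then have "integrable (measure_pmf p) ?E"
    using integrable_pmf_iff_summable_on[of p UNIV ?E] by simp
  then have "measure_pmf.expectation p ?E = infsum (\<lambda>x. ?E x * pmf p x) UNIV"
    using has_sum_expectation_pmf[of p UNIV ?E] by (simp add: infsumI)
  also have "\<dots> = infsum ?F (UNIV \<times> UNIV)"
    using infsum_Sigma'_banach[of "\<lambda>x y. f (x, y) * (pmf p x * pmf q y)" UNIV "\<lambda>_. UNIV"] s
    by (simp add: inner)
  also have "\<dots> = measure_pmf.expectation (pair_pmf p q) f"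
    using has_sum_expectation_pmf[of "pair_pmf p q" UNIV f] assms F by (simp add: infsumI)
  finally show ?thesis by simp
qed

section \<open>Domination, comparison and marginals\<close>

lemma integrable_pmf_bounded:
  fixes f :: "'a \<Rightarrow> real"
  assumes "\<And>x. x \<in> set_pmf p \<Longrightarrow> \<bar>f x\<bar> \<le> C"
  shows "integrable (measure_pmf p) f"
  using assms by (intro measure_pmf.integrable_const_bound[of _ C]) (auto simp: AE_measure_pmf_iff)

lemma integrable_pmf_dominated:
  fixes f h :: "'a \<Rightarrow> real"
  assumes "integrable (measure_pmf p) h" and "\<And>x. x \<in> set_pmf p \<Longrightarrow> \<bar>f x\<bar> \<le> h x"
  shows "integrable (measure_pmf p) f"
  using assms(2)
  by (intro Bochner_Integration.integrable_bound[OF assms(1)]) (force simp: AE_measure_pmf_iff)+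

lemma pmf_expectation_cong:
  fixes f h :: "'a \<Rightarrow> real"
  assumes "\<And>x. x \<in> set_pmf p \<Longrightarrow> f x = h x"
  shows "measure_pmf.expectation p f = measure_pmf.expectation p h"
  using assms by (intro integral_cong_AE) (auto simp: AE_measure_pmf_iff)

lemma pmf_expectation_mono:
  fixes f h :: "'a \<Rightarrow> real"
  assumes "integrable (measure_pmf p) f" "integrable (measure_pmf p) h"
    and "\<And>x. x \<in> set_pmf p \<Longrightarrow> f x \<le> h x"
  shows "measure_pmf.expectation p f \<le> measure_pmf.expectation p h"
  using assms by (intro integral_mono_AE) (auto simp: AE_measure_pmf_iff)

lemma integrable_pair_pmf_fst:
  fixes f :: "'a \<Rightarrow> real"
  assumes "integrable (measure_pmf p) f"
  shows "integrable (measure_pmf (pair_pmf p q)) (\<lambda>z. f (fst z))"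
  using assms integrable_map_pmf_eq[of fst "pair_pmf p q" f] by (simp add: map_fst_pair_pmf)

lemma integrable_pair_pmf_snd:
  fixes f :: "'b \<Rightarrow> real"
  assumes "integrable (measure_pmf q) f"
  shows "integrable (measure_pmf (pair_pmf p q)) (\<lambda>z. f (snd z))"
  using assms integrable_map_pmf_eq[of snd "pair_pmf p q" f] by (simp add: map_snd_pair_pmf)

lemma pmf_replicate_pmf:
  "length xs = n \<Longrightarrow> pmf (replicate_pmf n p) xs = prod_list (map (pmf p) xs)"
proof (induction n arbitrary: xs)
  case (Suc n)
  then obtain y ys where xs: "xs = y # ys" "length ys = n" by (cases xs) auto
  have "replicate_pmf (Suc n) p = map_pmf (\<lambda>z. fst z # snd z) (pair_pmf p (replicate_pmf n p))"
    by (simp add: pair_pmf_def map_pmf_def bind_assoc_pmf bind_return_pmf)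
  moreover have "inj (\<lambda>z :: 'a \<times> 'a list. fst z # snd z)"
    by (auto simp: inj_def)
  ultimately have "pmf (replicate_pmf (Suc n) p) xs = pmf (pair_pmf p (replicate_pmf n p)) (y, ys)"
    using pmf_map_inj'[of "\<lambda>z. fst z # snd z" _ "(y, ys)"] xs by simp
  then show ?case using Suc.IH xs by (simp add: pmf_pair)
qed simp

lemma pmf_bind_ge: "pmf p x * pmf (f x) y \<le> pmf (bind_pmf p f) y"
proof -
  have "pmf p x * pmf (f x) y = measure_pmf.expectation p (\<lambda>z. indicator {x} z * pmf (f x) y)"
    by (simp add: measure_pmf_single)
  also have "\<dots> \<le> measure_pmf.expectation p (\<lambda>z. pmf (f z) y)"
    by (intro pmf_expectation_mono integrable_pmf_bounded[of _ _ 1])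
      (auto simp: pmf_le_1 indicator_def)
  finally show ?thesis by (simp add: pmf_bind)
qed

lemma pmf_map_ge: "pmf p x \<le> pmf (map_pmf f p) (f x)"
proof -
  have "measure p {x} \<le> measure p (f -` {f x})"
    by (intro measure_pmf.finite_measure_mono) auto
  then show ?thesis by (simp add: measure_pmf_single pmf_map)
qed

section \<open>Entropy\<close>

text \<open>The weights of \<open>p\<close> cancel where they are positive; the mass that
  \<open>q\<close> puts elsewhere is lost, hence only an inequality. Working with the nonnegative
  integral yields integrability as well.\<close>

lemma change_of_measure_pmf:
  fixes g :: "'a \<Rightarrow> real"
  assumes g: "integrable (measure_pmf q) g" and nonneg: "\<And>x. g x \<ge> 0"
  shows "integrable (measure_pmf p) (\<lambda>x. g x * pmf q x / pmf p x)"
    and "measure_pmf.expectation p (\<lambda>x. g x * pmf q x / pmf p x) \<le> measure_pmf.expectation q g"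
proof -
  let ?h = "\<lambda>x. g x * pmf q x / pmf p x"
  have h0: "?h x \<ge> 0" for x using nonneg by simp
  have "(\<integral>\<^sup>+x. ennreal (?h x) \<partial>measure_pmf p) =
      (\<integral>\<^sup>+x. ennreal (pmf p x) * ennreal (?h x) \<partial>count_space UNIV)"
    unfolding measure_pmf_eq_density[of p] by (subst nn_integral_density) auto
  also have "\<dots> \<le> (\<integral>\<^sup>+x. ennreal (pmf q x) * ennreal (g x) \<partial>count_space UNIV)"
  proof (rule nn_integral_mono)
    fix x
    show "ennreal (pmf p x) * ennreal (?h x) \<le> ennreal (pmf q x) * ennreal (g x)"
      using nonneg[of x] h0[of x]
      by (cases "pmf p x = 0") (auto simp: ennreal_mult[symmetric] mult_ac intro!: ennreal_leI)
  qed
  also have "\<dots> = (\<integral>\<^sup>+x. ennreal (g x) \<partial>measure_pmf q)"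
    unfolding measure_pmf_eq_density[of q] by (subst nn_integral_density) auto
  also have "\<dots> = ennreal (measure_pmf.expectation q g)"
    using g nonneg by (intro nn_integral_eq_integral) auto
  finally have le: "(\<integral>\<^sup>+x. ennreal (?h x) \<partial>measure_pmf p) \<le> ennreal (measure_pmf.expectation q g)" .
  show int: "integrable (measure_pmf p) ?h"
  proof (rule integrableI_nonneg)
    show "(\<integral>\<^sup>+x. ennreal (?h x) \<partial>measure_pmf p) < \<infinity>"
      using le by (simp add: le_less_trans)
  qed (use h0 in auto)
  have "ennreal (measure_pmf.expectation p ?h) \<le> ennreal (measure_pmf.expectation q g)"
    using le h0 int by (subst (asm) nn_integral_eq_integral) auto
  moreover have "measure_pmf.expectation q g \<ge> 0" using nonneg by (intro integral_nonneg_AE) auto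
  ultimately show "measure_pmf.expectation p ?h \<le> measure_pmf.expectation q g"
    by simp
qed

text \<open>Integrate \<open>ln y \<le> y - 1\<close> under \<open>p\<close> with
  \<open>y = exp (f x) * pmf q x / pmf p x\<close>. This bounds the relative entropy of
  \<open>p\<close> with respect to \<open>q\<close> from below by means of a test function
  \<open>f\<close>; the relative entropy is split into two integrals so that entropies can be read
  off.\<close>

lemma gibbs_variational_inequality:
  fixes f :: "'a \<Rightarrow> real"
  assumes sub: "set_pmf p \<subseteq> set_pmf q"
    and f: "integrable (measure_pmf p) f"
    and lp: "integrable (measure_pmf p) (\<lambda>x. ln (pmf p x))"
    and lq: "integrable (measure_pmf p) (\<lambda>x. ln (pmf q x))"
    and ef: "integrable (measure_pmf q) (\<lambda>x. exp (f x))"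
  shows "measure_pmf.expectation p f + measure_pmf.expectation p (\<lambda>x. ln (pmf q x)) -
    measure_pmf.expectation p (\<lambda>x. ln (pmf p x)) \<le> measure_pmf.expectation q (\<lambda>x. exp (f x)) - 1"
proof -
  let ?h = "\<lambda>x. exp (f x) * pmf q x / pmf p x"
  have h: "integrable (measure_pmf p) ?h"
    "measure_pmf.expectation p ?h \<le> measure_pmf.expectation q (\<lambda>x. exp (f x))"
    using change_of_measure_pmf[OF ef, of p] by auto
  have "measure_pmf.expectation p (\<lambda>x. f x + ln (pmf q x) - ln (pmf p x))
      \<le> measure_pmf.expectation p (\<lambda>x. ?h x - 1)"
  proof (rule integral_mono_AE)
    show "AE x in measure_pmf p. f x + ln (pmf q x) - ln (pmf p x) \<le> ?h x - 1"
    proof (subst AE_measure_pmf_iff, intro ballI)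
      fix x assume x: "x \<in> set_pmf p"
      then have pos: "pmf p x > 0" "pmf q x > 0"
        using sub by (auto simp: pmf_positive)
      then have "ln (?h x) = f x + ln (pmf q x) - ln (pmf p x)"
        by (simp add: ln_mult ln_div)
      moreover have "ln (?h x) \<le> ?h x - 1"
        using pos by (intro ln_le_minus_one) simp
      ultimately show "f x + ln (pmf q x) - ln (pmf p x) \<le> ?h x - 1" by simp
    qed
  qed (use f lp lq h in auto)
  then show ?thesis using f lp lq h by simp
qed

text \<open>The inequality is Gibbs with test function \<open>0\<close>. For integrability,
  \<open>ln (pmf p x) \<le> 0\<close> leaves only an upper bound for \<open>- ln (pmf p x)\<close>
  to find, and \<open>ln y \<le> y - 1\<close> gives
  \<open>pmf w x / pmf p x - ln (pmf w x)\<close>, whose first term is integrable by change of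
  measure.\<close>

lemma entropy_le_cross_entropy:
  assumes sub: "set_pmf p \<subseteq> set_pmf w"
    and lw: "integrable (measure_pmf p) (\<lambda>x. ln (pmf w x))"
  shows "integrable (measure_pmf p) (\<lambda>x. ln (pmf p x))"
    and "- measure_pmf.expectation p (\<lambda>x. ln (pmf p x)) \<le>
      - measure_pmf.expectation p (\<lambda>x. ln (pmf w x))"
proof -
  have r: "integrable (measure_pmf p) (\<lambda>x. pmf w x / pmf p x)"
    using change_of_measure_pmf(1)[of w "\<lambda>_. 1" p] by simp
  show lp: "integrable (measure_pmf p) (\<lambda>x. ln (pmf p x))"
  proof (rule Bochner_Integration.integrable_bound)
    show "integrable (measure_pmf p) (\<lambda>x. pmf w x / pmf p x - ln (pmf w x))"
      using r lw by simp
    show "AE x in measure_pmf p. norm (ln (pmf p x)) \<le> norm (pmf w x / pmf p x - ln (pmf w x))"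
    proof (subst AE_measure_pmf_iff, intro ballI)
      fix x assume x: "x \<in> set_pmf p"
      then have pos: "pmf p x > 0" "pmf w x > 0"
        using sub by (auto simp: pmf_positive)
      have "ln (pmf w x / pmf p x) \<le> pmf w x / pmf p x - 1"
        using pos by (intro ln_le_minus_one) simp
      then have "- ln (pmf p x) \<le> pmf w x / pmf p x - ln (pmf w x)"
        using pos by (simp add: ln_div)
      moreover have "ln (pmf p x) \<le> 0" using pos by (simp add: pmf_le_1)
      ultimately show "norm (ln (pmf p x)) \<le> norm (pmf w x / pmf p x - ln (pmf w x))" by simp
    qed
  qed auto
  show "- measure_pmf.expectation p (\<lambda>x. ln (pmf p x)) \<le>
      - measure_pmf.expectation p (\<lambda>x. ln (pmf w x))"
    using gibbs_variational_inequality[OF sub _ lp lw, of "\<lambda>_. 0"] by simp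
qed

section \<open>Real sequences\<close>

text \<open>Fekete's argument: divide \<open>n\<close> by some \<open>m\<close> for which
  \<open>a m / real m\<close> is close to the infimum \<open>L\<close>.\<close>

lemma fekete_quotient_convergent:
  fixes a :: "nat \<Rightarrow> real"
  assumes nonneg: "\<And>n. a n \<ge> 0" and sub: "\<And>m n. a (m + n) \<le> a m + a n"
  shows "convergent (\<lambda>n. a n / real n)"
proof -
  define L where "L = Inf ((\<lambda>n. a n / real n) ` {1..})"
  have bdd: "bdd_below ((\<lambda>n. a n / real n) ` {1..})"
    using nonneg by (intro bdd_belowI[of _ 0]) auto
  have mult: "a (k * m + r) \<le> real k * a m + a r" for k m r
  proof (induction k)
    case (Suc k)
    have "a (Suc k * m + r) \<le> a m + a (k * m + r)" using sub[of m "k * m + r"] by (simp add: add_ac)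
    then show ?case using Suc by (simp add: algebra_simps)
  qed simp
  have "(\<lambda>n. a n / real n) \<longlonglongrightarrow> L"
  proof (rule tendstoI)
    fix e :: real assume e: "e > 0"
    have "\<exists>y\<in>(\<lambda>n. a n / real n) ` {1..}. y < L + e / 2"
      using e unfolding L_def by (intro cInf_lessD) auto
    then obtain m where m: "m \<ge> 1" "a m / real m < L + e / 2" by auto
    \<comment> \<open>\<open>C\<close> dominates every remainder term \<open>a (n mod m)\<close>, so
      its contribution \<open>C / real n\<close> vanishes.\<close>
    define C where "C = (\<Sum>r<m. a r)"
    have C: "a r \<le> C" if "r < m" for r
      unfolding C_def using that nonneg by (intro member_le_sum) auto
    have upper: "a n / real n \<le> a m / real m + C / real n" if n: "n \<ge> 1" for n
    proof -
      have "a n \<le> real (n div m) * a m + a (n mod m)"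
        using mult[of "n div m" m "n mod m"] by simp
      also have "\<dots> \<le> (real n / real m) * a m + C"
        using C[of "n mod m"] m nonneg[of m]
        by (intro add_mono mult_right_mono of_nat_div_le_of_nat) auto
      finally show ?thesis using n by (simp add: field_simps)
    qed
    have "(\<lambda>n. C / real n) \<longlonglongrightarrow> 0" by real_asymp
    then have "\<forall>\<^sub>F n in sequentially. C / real n < e / 2"
      using e by (intro order_tendstoD) auto
    then show "\<forall>\<^sub>F n in sequentially. dist (a n / real n) L < e"
      using eventually_ge_at_top[of 1]
    proof eventually_elim
      case (elim n)
      have "L \<le> a n / real n"
        unfolding L_def using elim bdd by (intro cInf_lower) auto
      moreover have "a n / real n < L + e" using upper[of n] elim m by linarith
      ultimately show ?case by (simp add: dist_real_def)
    qed
  qed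
  then show ?thesis by (rule convergentI)
qed

lemma pointwise_convergent_subsequence:
  fixes f :: "nat \<Rightarrow> 'a \<Rightarrow> real"
  assumes "countable S" and bd: "\<And>n x. x \<in> S \<Longrightarrow> \<bar>f n x\<bar> \<le> b x"
  obtains r l where "strict_mono (r :: nat \<Rightarrow> nat)" "\<And>x. x \<in> S \<Longrightarrow> (\<lambda>n. f (r n) x) \<longlonglongrightarrow> l x"
proof -
  \<comment> \<open>The diagonal extraction requires one bound for all points; dividing by the
    positive number \<open>c x\<close> makes it \<open>1\<close>.\<close>
  define c where "c x = \<bar>b x\<bar> + 1" for x
  have c: "c x > 0" for x by (simp add: c_def add_nonneg_pos)
  have "norm (f n x / c x) \<le> 1" if "x \<in> S" for n x
    using bd[OF that, of n] c[of x] by (simp add: c_def)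
  then obtain r where r: "strict_mono (r :: nat \<Rightarrow> nat)"
    "\<And>x. x \<in> S \<Longrightarrow> \<exists>l. (\<lambda>n. f (r n) x / c x) \<longlonglongrightarrow> l"
    using function_convergent_subsequence[OF assms(1), of "\<lambda>n x. f n x / c x" 1] by metis
  have "\<exists>l. (\<lambda>n. f (r n) x) \<longlonglongrightarrow> l" if x: "x \<in> S" for x
  proof -
    obtain l where "(\<lambda>n. f (r n) x / c x) \<longlonglongrightarrow> l" using r(2)[OF x] by blast
    then have "(\<lambda>n. f (r n) x / c x * c x) \<longlonglongrightarrow> l * c x" by (intro tendsto_intros)
    then show ?thesis using c[of x] by auto
  qed
  then show ?thesis using that[OF r(1)] by metis
qed

section \<open>The random walk\<close>

context measured_group
begin

text \<open>New factors enter on the left, so unfolding \<open>Suc n\<close> isolates the first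
  increment; later arguments condition on it.\<close>

primrec walk :: "nat \<Rightarrow> 'a pmf" where
  "walk 0 = return_pmf \<one>"
| "walk (Suc n) = map_pmf (\<lambda>(x, y). x \<otimes> y) (pair_pmf \<mu> (walk n))"

lemma set_walk: "set_pmf (walk n) \<subseteq> carrier G"
  using support_subset by (induction n) auto

lemma in_walk: "x \<in> set_pmf (walk n) \<Longrightarrow> x \<in> carrier G"
  using set_walk by blast

lemma in_step: "x \<in> set_pmf \<mu> \<Longrightarrow> x \<in> carrier G"
  using support_subset by blast

lemma walk_add: "walk (m + n) = map_pmf (\<lambda>(x, y). x \<otimes> y) (pair_pmf (walk m) (walk n))"
proof (induction m)
  case 0
  have "map_pmf (\<lambda>(x, y). x \<otimes> y) (pair_pmf (walk 0) (walk n)) = map_pmf (\<lambda>y. \<one> \<otimes> y) (walk n)"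
    by (simp add: pair_return_pmf1 map_pmf_comp)
  also have "\<dots> = map_pmf (\<lambda>y. y) (walk n)"
    by (intro map_pmf_cong) (auto dest: in_walk)
  finally show ?case by (simp add: map_pmf_ident)
next
  case (Suc m)
  have "walk (Suc m + n) =
      bind_pmf \<mu> (\<lambda>x. bind_pmf (walk m) (\<lambda>y. bind_pmf (walk n) (\<lambda>z. return_pmf (x \<otimes> (y \<otimes> z)))))"
    using Suc by (simp add: pair_pmf_def map_pmf_def bind_assoc_pmf bind_return_pmf)
  also have "\<dots> =
      bind_pmf \<mu> (\<lambda>x. bind_pmf (walk m) (\<lambda>y. bind_pmf (walk n) (\<lambda>z. return_pmf (x \<otimes> y \<otimes> z))))"
    by (intro bind_pmf_cong refl arg_cong[of _ _ return_pmf])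
      (auto dest!: in_walk in_step simp: m_assoc)
  also have "\<dots> = map_pmf (\<lambda>(x, y). x \<otimes> y) (pair_pmf (walk (Suc m)) (walk n))"
    by (simp add: pair_pmf_def map_pmf_def bind_assoc_pmf bind_return_pmf)
  finally show ?case .
qed

lemma walk_eq_replicate: "walk n = map_pmf (list_mult G) (replicate_pmf n \<mu>)"
proof (induction n)
  case 0
  then show ?case by (simp add: list_mult_def)
next
  case (Suc n)
  then show ?case
    by (simp add: pair_pmf_def map_pmf_def bind_assoc_pmf bind_return_pmf list_mult_def)
qed

text \<open>The sum over tuples is the probability that \<open>n\<close> independent steps multiply
  to \<open>s\<close>.\<close>

lemma conv_power_eq_pmf_walk: "conv_power G \<mu> n s = pmf (walk n) s"
proof -
  define A where "A = {xs. length xs = n \<and> set xs \<subseteq> carrier G \<and> list_mult G xs = s}"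
  let ?r = "replicate_pmf n \<mu>"
  have "conv_power G \<mu> n s = infsum (pmf ?r) A"
    unfolding conv_power_def A_def by (intro infsum_cong) (simp add: pmf_replicate_pmf)
  also have "\<dots> = infsetsum (pmf ?r) A"
    by (intro infsetsum_infsum[symmetric] pmf_abs_summable)
  also have "\<dots> = measure ?r A" by (simp add: measure_pmf_conv_infsetsum)
  \<comment> \<open>Tuples with an entry outside the carrier have probability zero.\<close>
  also have "\<dots> = measure ?r (list_mult G -` {s})"
    using support_subset
    by (intro measure_pmf.finite_measure_eq_AE)
      (auto simp: AE_measure_pmf_iff set_replicate_pmf A_def)
  also have "\<dots> = pmf (walk n) s" by (simp add: walk_eq_replicate pmf_map)
  finally show ?thesis .
qed

section \<open>Conditioning on the first step, harmonic functions and symmetry\<close>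

lemma expectation_walk_Suc:
  fixes f :: "'a \<Rightarrow> real"
  assumes "integrable (measure_pmf (walk (Suc n))) f"
  shows "measure_pmf.expectation (walk (Suc n)) f =
    measure_pmf.expectation \<mu> (\<lambda>x. measure_pmf.expectation (walk n) (\<lambda>y. f (x \<otimes> y)))"
proof -
  have "integrable (measure_pmf (pair_pmf \<mu> (walk n))) (\<lambda>z. f (case z of (x, y) \<Rightarrow> x \<otimes> y))"
    using assms by simp
  from expectation_pair_pmf[OF this] show ?thesis by simp
qed

lemma expectation_harmonic:
  assumes u: "harmonic G \<mu> u" and M: "\<And>g. g \<in> carrier G \<Longrightarrow> \<bar>u g\<bar> \<le> M" and g: "g \<in> carrier G"
  shows "measure_pmf.expectation \<mu> (\<lambda>x. u (g \<otimes> x)) = u g"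
proof -
  have "integrable (measure_pmf \<mu>) (\<lambda>x. u (g \<otimes> x))"
    using M g by (intro integrable_pmf_bounded[of _ _ M]) (auto dest: in_step)
  from has_sum_expectation_pmf[OF support_subset this] show ?thesis
    using u g has_sum_unique by (fastforce simp: harmonic_def)
qed

text \<open>Induction with \<open>g\<close> arbitrary: after a first step \<open>x\<close> the
  induction hypothesis applies at \<open>g \<otimes> x\<close>, and harmonicity averages over
  \<open>x\<close>.\<close>

lemma expectation_walk_harmonic:
  assumes u: "harmonic G \<mu> u" and M: "\<And>g. g \<in> carrier G \<Longrightarrow> \<bar>u g\<bar> \<le> M" and g: "g \<in> carrier G"
  shows "measure_pmf.expectation (walk n) (\<lambda>y. u (g \<otimes> y)) = u g"
  using g
proof (induction n arbitrary: g)
  case (Suc n)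
  have "integrable (measure_pmf (walk (Suc n))) (\<lambda>y. u (g \<otimes> y))"
    using M Suc.prems by (intro integrable_pmf_bounded[of _ _ M]) (auto dest!: in_walk in_step)
  then have "measure_pmf.expectation (walk (Suc n)) (\<lambda>y. u (g \<otimes> y)) =
      measure_pmf.expectation \<mu> (\<lambda>x. measure_pmf.expectation (walk n) (\<lambda>y. u (g \<otimes> (x \<otimes> y))))"
    by (rule expectation_walk_Suc)
  also have "\<dots> = measure_pmf.expectation \<mu> (\<lambda>x. u (g \<otimes> x))"
  proof (rule pmf_expectation_cong)
    fix x assume "x \<in> set_pmf \<mu>"
    then have x: "x \<in> carrier G" by (rule in_step)
    have "measure_pmf.expectation (walk n) (\<lambda>y. u (g \<otimes> (x \<otimes> y))) =
        measure_pmf.expectation (walk n) (\<lambda>y. u (g \<otimes> x \<otimes> y))"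
      using x Suc.prems by (intro pmf_expectation_cong) (auto dest!: in_walk simp: m_assoc)
    then show "measure_pmf.expectation (walk n) (\<lambda>y. u (g \<otimes> (x \<otimes> y))) = u (g \<otimes> x)"
      using Suc.IH x Suc.prems by simp
  qed
  also have "\<dots> = u g" using expectation_harmonic[OF u M] Suc.prems by blast
  finally show ?case .
qed simp

text \<open>Symmetry as invariance of the law. \<open>symmetric_measure\<close> speaks only of the
  carrier; elsewhere both weights are zero.\<close>

lemma map_inv_step:
  assumes "symmetric_measure G \<mu>"
  shows "map_pmf (\<lambda>x. inv x) \<mu> = \<mu>"
proof (rule pmf_eqI)
  fix s
  show "pmf (map_pmf (\<lambda>x. inv x) \<mu>) s = pmf \<mu> s"
  proof (cases "s \<in> carrier G")
    case True
    have "pmf (map_pmf (\<lambda>x. inv x) \<mu>) s = measure \<mu> {inv s}"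
      unfolding pmf_map using True
      by (intro measure_pmf.finite_measure_eq_AE) (auto simp: AE_measure_pmf_iff dest: in_step)
    then show ?thesis
      using assms True by (simp add: measure_pmf_single symmetric_measure_def)
  next
    case False
    then have "s \<notin> set_pmf (map_pmf (\<lambda>x. inv x) \<mu>)" "s \<notin> set_pmf \<mu>"
      by (auto dest: in_step)
    then show ?thesis by (metis pmf_eq_0_set_pmf)
  qed
qed

end

section \<open>Lengths on a group\<close>

text \<open>The axioms isolate what the walk arguments use of a word norm: subadditivity, symmetry
  under inversion and an integrable step.\<close>

locale length_group = measured_group +
  fixes \<rho> :: "'a \<Rightarrow> real"
  assumes length_one: "\<rho> \<one> = 0"
    and length_nonneg: "g \<in> carrier G \<Longrightarrow> 0 \<le> \<rho> g"
    and length_mult: "\<lbrakk>g \<in> carrier G; h \<in> carrier G\<rbrakk> \<Longrightarrow> \<rho> (g \<otimes> h) \<le> \<rho> g + \<rho> h"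
    and length_inv: "g \<in> carrier G \<Longrightarrow> \<rho> (inv g) = \<rho> g"
    and length_integrable: "integrable (measure_pmf \<mu>) \<rho>"
begin

section \<open>Mean length and drift\<close>

lemma integrable_walk_length: "integrable (measure_pmf (walk n)) \<rho>"
proof (induction n)
  case 0
  then show ?case by (intro integrable_measure_pmf_finite) simp
next
  case (Suc n)
  have "integrable (measure_pmf (pair_pmf \<mu> (walk n))) (\<lambda>z. \<rho> (case z of (x, y) \<Rightarrow> x \<otimes> y))"
  proof (rule integrable_pmf_dominated)
    show "integrable (measure_pmf (pair_pmf \<mu> (walk n))) (\<lambda>z. \<rho> (fst z) + \<rho> (snd z))"
      using Suc length_integrable
      by (intro Bochner_Integration.integrable_add integrable_pair_pmf_fst integrable_pair_pmf_snd)
    show "\<bar>\<rho> (case z of (x, y) \<Rightarrow> x \<otimes> y)\<bar> \<le> \<rho> (fst z) + \<rho> (snd z)"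
      if "z \<in> set_pmf (pair_pmf \<mu> (walk n))" for z
      using that by (auto dest!: in_walk in_step intro: length_mult simp: length_nonneg)
  qed
  then show ?case by simp
qed

definition mean_length :: "nat \<Rightarrow> real" where
  "mean_length n = measure_pmf.expectation (walk n) \<rho>"

lemma mean_length_nonneg: "0 \<le> mean_length n"
  unfolding mean_length_def
  by (intro integral_nonneg_AE) (auto simp: AE_measure_pmf_iff dest!: in_walk length_nonneg)

lemma mean_length_0: "mean_length 0 = 0"
  by (simp add: mean_length_def length_one)

text \<open>\<open>walk (m + n)\<close> is the law of a product of independent variables with laws
  \<open>walk m\<close> and \<open>walk n\<close>, so subadditivity of the length passes to
  means.\<close>

lemma mean_length_add: "mean_length (m + n) \<le> mean_length m + mean_length n"
proof -
  let ?P = "pair_pmf (walk m) (walk n)"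
  have "integrable (measure_pmf (map_pmf (\<lambda>(x, y). x \<otimes> y) ?P)) \<rho>"
    using integrable_walk_length[of "m + n"] by (simp only: walk_add)
  then have i: "integrable (measure_pmf ?P) (\<lambda>z. \<rho> (case z of (x, y) \<Rightarrow> x \<otimes> y))" by simp
  have i1: "integrable (measure_pmf ?P) (\<lambda>z. \<rho> (fst z))"
    and i2: "integrable (measure_pmf ?P) (\<lambda>z. \<rho> (snd z))"
    by (intro integrable_pair_pmf_fst integrable_pair_pmf_snd integrable_walk_length)+
  have "mean_length (m + n) = measure_pmf.expectation ?P (\<lambda>z. \<rho> (case z of (x, y) \<Rightarrow> x \<otimes> y))"
    by (simp add: mean_length_def walk_add)
  also have "\<dots> \<le> measure_pmf.expectation ?P (\<lambda>z. \<rho> (fst z) + \<rho> (snd z))"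
    using i i1 i2
    by (intro pmf_expectation_mono) (auto dest!: in_walk intro: length_mult)
  also have "\<dots> = mean_length m + mean_length n"
    using i1 i2 by (simp add: mean_length_def)
  finally show ?thesis .
qed

lemma mean_length_quotient_convergent: "convergent (\<lambda>n. mean_length n / real n)"
  by (intro fekete_quotient_convergent mean_length_nonneg mean_length_add)

lemma infsum_length_conv_power:
  "(\<Sum>\<^sub>\<infinity>s\<in>carrier G. \<rho> s * conv_power G \<mu> n s) = mean_length n"
  using has_sum_expectation_pmf[OF set_walk integrable_walk_length, of n]
  by (simp add: conv_power_eq_pmf_walk mean_length_def infsumI)

text \<open>\<open>drift\<close> is a \<open>lim\<close>, which is informative only once the
  quotients converge; subadditivity supplies that.\<close>

lemma mean_length_quotient_tendsto_drift: "(\<lambda>n. mean_length n / real n) \<longlonglongrightarrow> drift G \<rho> \<mu>"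
  using mean_length_quotient_convergent
  by (simp add: drift_def infsum_length_conv_power convergent_LIMSEQ_iff)

text \<open>Writing \<open>s\<close> as \<open>inv g \<otimes> (g \<otimes> s)\<close> yields the
  lower bound. The estimate is uniform in \<open>s\<close>, hence gives bounds uniform in the time
  of the walk.\<close>

lemma length_diff_bound:
  assumes "g \<in> carrier G" "s \<in> carrier G"
  shows "\<bar>\<rho> (g \<otimes> s) - \<rho> s\<bar> \<le> \<rho> g"
proof -
  have "\<rho> s = \<rho> (inv g \<otimes> (g \<otimes> s))" using assms by (simp add: m_assoc[symmetric])
  also have "\<dots> \<le> \<rho> g + \<rho> (g \<otimes> s)"
    using length_mult[of "inv g" "g \<otimes> s"] assms by (simp add: length_inv)
  finally show ?thesis using length_mult[of g s] assms by simp
qed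

section \<open>The Liouville property forces zero drift\<close>

text \<open>For the left-invariant pseudometric \<open>dist a b = \<rho> (inv a \<otimes> b)\<close>
  the integrand is \<open>dist (inv g) y - dist \<one> y\<close>, so this is a horofunction averaged
  over the position \<open>y\<close> of the walk.\<close>

definition displacement :: "nat \<Rightarrow> 'a \<Rightarrow> real" where
  "displacement n g = measure_pmf.expectation (walk n) (\<lambda>y. \<rho> (g \<otimes> y) - \<rho> y)"

lemma integrable_length_diff:
  assumes "g \<in> carrier G" "h \<in> carrier G"
  shows "integrable (measure_pmf (walk n)) (\<lambda>y. \<rho> (g \<otimes> (h \<otimes> y)) - \<rho> (h \<otimes> y))"
  using assms
  by (intro integrable_pmf_bounded[of _ _ "\<rho> g"]) (auto dest!: in_walk intro!: length_diff_bound)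

lemma integrable_length_diff':
  assumes "g \<in> carrier G"
  shows "integrable (measure_pmf (walk n)) (\<lambda>y. \<rho> (g \<otimes> y) - \<rho> y)"
  using assms
  by (intro integrable_pmf_bounded[of _ _ "\<rho> g"]) (auto dest!: in_walk intro!: length_diff_bound)

lemma displacement_bound:
  assumes "g \<in> carrier G"
  shows "\<bar>displacement n g\<bar> \<le> \<rho> g"
proof -
  have "\<bar>displacement n g\<bar> \<le> measure_pmf.expectation (walk n) (\<lambda>y. \<bar>\<rho> (g \<otimes> y) - \<rho> y\<bar>)"
    unfolding displacement_def by (rule integral_abs_bound)
  also have "\<dots> \<le> measure_pmf.expectation (walk n) (\<lambda>y. \<rho> g)"
    using integrable_length_diff'[OF assms, of n] assms
    by (intro pmf_expectation_mono) (auto dest!: in_walk intro!: length_diff_bound)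
  finally show ?thesis by simp
qed

lemma displacement_one: "displacement n \<one> = 0"
proof -
  have "displacement n \<one> = measure_pmf.expectation (walk n) (\<lambda>y. 0)"
    unfolding displacement_def by (intro pmf_expectation_cong) (auto dest!: in_walk)
  then show ?thesis by simp
qed

text \<open>If \<open>x\<close> is a step independent of \<open>y\<close>, then
  \<open>x \<otimes> y\<close> has law \<open>walk (Suc n)\<close>.\<close>

lemma expectation_displacement:
  "measure_pmf.expectation \<mu> (displacement n) = mean_length (Suc n) - mean_length n"
proof -
  let ?P = "pair_pmf \<mu> (walk n)"
  have i1: "integrable (measure_pmf ?P) (\<lambda>z. \<rho> (case z of (x, y) \<Rightarrow> x \<otimes> y))"
    using integrable_walk_length[of "Suc n"] by simp
  have i2: "integrable (measure_pmf ?P) (\<lambda>z. \<rho> (snd z))"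
    by (intro integrable_pair_pmf_snd integrable_walk_length)
  have "mean_length (Suc n) - mean_length n =
      measure_pmf.expectation ?P (\<lambda>z. \<rho> (case z of (x, y) \<Rightarrow> x \<otimes> y) - \<rho> (snd z))"
    using i1 i2 by (simp add: mean_length_def)
  also have "\<dots> = measure_pmf.expectation \<mu> (displacement n)"
    using i1 i2 by (subst expectation_pair_pmf) (auto simp: displacement_def[abs_def])
  finally show ?thesis by simp
qed

text \<open>The terms \<open>\<rho> y\<close> cancel, leaving an integrand bounded by
  \<open>\<rho> g\<close> uniformly in \<open>h\<close>. This uniformity makes the harmonic function
  of the Liouville argument bounded.\<close>

lemma displacement_diff:
  assumes "g \<in> carrier G" "h \<in> carrier G"
  shows "displacement n (g \<otimes> h) - displacement n h =
    measure_pmf.expectation (walk n) (\<lambda>y. \<rho> (g \<otimes> (h \<otimes> y)) - \<rho> (h \<otimes> y))"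
proof -
  have "displacement n (g \<otimes> h) - displacement n h =
      measure_pmf.expectation (walk n) (\<lambda>y. (\<rho> (g \<otimes> h \<otimes> y) - \<rho> y) - (\<rho> (h \<otimes> y) - \<rho> y))"
    unfolding displacement_def
    using assms integrable_length_diff'
    by (intro Bochner_Integration.integral_diff[symmetric]) auto
  also have "\<dots> = measure_pmf.expectation (walk n) (\<lambda>y. \<rho> (g \<otimes> (h \<otimes> y)) - \<rho> (h \<otimes> y))"
    using assms by (intro pmf_expectation_cong) (auto dest!: in_walk simp: m_assoc)
  finally show ?thesis .
qed

lemma displacement_diff_bound:
  assumes "g \<in> carrier G" "h \<in> carrier G"
  shows "\<bar>displacement n (g \<otimes> h) - displacement n h\<bar> \<le> \<rho> g"
proof -
  have "\<bar>displacement n (g \<otimes> h) - displacement n h\<bar> \<le>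
      measure_pmf.expectation (walk n) (\<lambda>y. \<bar>\<rho> (g \<otimes> (h \<otimes> y)) - \<rho> (h \<otimes> y)\<bar>)"
    unfolding displacement_diff[OF assms] by (rule integral_abs_bound)
  also have "\<dots> \<le> measure_pmf.expectation (walk n) (\<lambda>y. \<rho> g)"
    using integrable_length_diff[OF assms, of n] assms
    by (intro pmf_expectation_mono) (auto dest!: in_walk intro!: length_diff_bound)
  finally show ?thesis by simp
qed

text \<open>Moving \<open>h\<close> by a step \<open>x\<close> prefixes \<open>x\<close> to the
  walk, so the time index rises by one: the difference is harmonic up to a shift of time.\<close>

lemma expectation_displacement_diff:
  assumes g: "g \<in> carrier G" and h: "h \<in> carrier G"
  shows "measure_pmf.expectation \<mu> (\<lambda>x. displacement n (g \<otimes> (h \<otimes> x)) - displacement n (h \<otimes> x)) =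
    displacement (Suc n) (g \<otimes> h) - displacement (Suc n) h"
proof -
  have "displacement (Suc n) (g \<otimes> h) - displacement (Suc n) h =
      measure_pmf.expectation \<mu> (\<lambda>x. measure_pmf.expectation (walk n)
        (\<lambda>y. \<rho> (g \<otimes> (h \<otimes> (x \<otimes> y))) - \<rho> (h \<otimes> (x \<otimes> y))))"
    using integrable_length_diff[OF g h]
    unfolding displacement_diff[OF g h] by (rule expectation_walk_Suc)
  also have "\<dots> = measure_pmf.expectation \<mu>
      (\<lambda>x. displacement n (g \<otimes> (h \<otimes> x)) - displacement n (h \<otimes> x))"
  proof (rule pmf_expectation_cong)
    fix x assume "x \<in> set_pmf \<mu>"
    then have x: "x \<in> carrier G" by (rule in_step)
    show "measure_pmf.expectation (walk n)
        (\<lambda>y. \<rho> (g \<otimes> (h \<otimes> (x \<otimes> y))) - \<rho> (h \<otimes> (x \<otimes> y))) =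
        displacement n (g \<otimes> (h \<otimes> x)) - displacement n (h \<otimes> x)"
      using x g h
      by (subst displacement_diff)
        (auto intro!: pmf_expectation_cong dest!: in_walk simp: m_assoc)
  qed
  finally show ?thesis by simp
qed

text \<open>Averaging over time reduces the shift in \<open>expectation_displacement_diff\<close> to
  a boundary term divided by \<open>N\<close>.\<close>

definition mean_displacement :: "nat \<Rightarrow> 'a \<Rightarrow> real" where
  "mean_displacement N g = (\<Sum>n<N. displacement n g) / real N"

lemma mean_displacement_bound:
  assumes "g \<in> carrier G"
  shows "\<bar>mean_displacement N g\<bar> \<le> \<rho> g"
proof -
  have "\<bar>\<Sum>n<N. displacement n g\<bar> \<le> (\<Sum>n<N. \<rho> g)"
    using displacement_bound[OF assms] by (intro order.trans[OF sum_abs] sum_mono) auto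
  then have "\<bar>\<Sum>n<N. displacement n g\<bar> / real N \<le> \<rho> g"
    using length_nonneg[OF assms] by (cases "N = 0") (auto simp: field_simps)
  then show ?thesis by (simp add: mean_displacement_def abs_divide)
qed

lemma mean_displacement_diff_bound:
  assumes "g \<in> carrier G" "h \<in> carrier G"
  shows "\<bar>mean_displacement N (g \<otimes> h) - mean_displacement N h\<bar> \<le> \<rho> g"
proof -
  have "\<bar>\<Sum>n<N. displacement n (g \<otimes> h) - displacement n h\<bar> \<le> (\<Sum>n<N. \<rho> g)"
    using displacement_diff_bound[OF assms] by (intro order.trans[OF sum_abs] sum_mono) auto
  then have "\<bar>\<Sum>n<N. displacement n (g \<otimes> h) - displacement n h\<bar> / real N \<le> \<rho> g"
    using length_nonneg[OF assms(1)] by (cases "N = 0") (auto simp: field_simps)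
  then show ?thesis
    by (simp add: mean_displacement_def sum_subtractf diff_divide_distrib[symmetric] abs_divide)
qed

text \<open>The increments of \<open>mean_length\<close> telescope from
  \<open>mean_length 0 = 0\<close>; this ties the averaged displacement to the drift.\<close>

lemma expectation_mean_displacement:
  "measure_pmf.expectation \<mu> (mean_displacement N) = mean_length N / real N"
proof -
  have i: "integrable (measure_pmf \<mu>) (displacement n)" for n
    using displacement_bound
    by (intro integrable_pmf_dominated[OF length_integrable]) (auto dest: in_step)
  have "measure_pmf.expectation \<mu> (mean_displacement N) =
      (\<Sum>n<N. measure_pmf.expectation \<mu> (displacement n)) / real N"
    using i by (simp add: mean_displacement_def[abs_def])
  also have "\<dots> = (\<Sum>n<N. mean_length (Suc n) - mean_length n) / real N"
    by (simp add: expectation_displacement)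
  also have "\<dots> = mean_length N / real N"
    by (simp add: sum_lessThan_telescope mean_length_0)
  finally show ?thesis .
qed

text \<open>Harmonicity fails only by the two ends of a telescoping sum, both bounded independently
  of \<open>N\<close>.\<close>

lemma expectation_mean_displacement_diff:
  assumes g: "g \<in> carrier G" and h: "h \<in> carrier G"
  shows "measure_pmf.expectation \<mu>
      (\<lambda>x. mean_displacement N (g \<otimes> (h \<otimes> x)) - mean_displacement N (h \<otimes> x)) =
    mean_displacement N (g \<otimes> h) - mean_displacement N h +
    ((displacement N (g \<otimes> h) - displacement N h) - (displacement 0 (g \<otimes> h) - displacement 0 h))
      / real N"
proof -
  let ?D = "\<lambda>n k. displacement n (g \<otimes> k) - displacement n k"
  have i: "integrable (measure_pmf \<mu>) (\<lambda>x. ?D n (h \<otimes> x))" for n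
    using displacement_diff_bound g h
    by (intro integrable_pmf_bounded[of _ _ "\<rho> g"]) (auto dest: in_step)
  have sum: "mean_displacement N (g \<otimes> k) - mean_displacement N k = (\<Sum>n<N. ?D n k) / real N" for k
    by (simp add: mean_displacement_def sum_subtractf diff_divide_distrib)
  have "measure_pmf.expectation \<mu>
      (\<lambda>x. mean_displacement N (g \<otimes> (h \<otimes> x)) - mean_displacement N (h \<otimes> x)) =
      (\<Sum>n<N. measure_pmf.expectation \<mu> (\<lambda>x. ?D n (h \<otimes> x))) / real N"
    unfolding sum using i by (subst integral_divide_zero, subst Bochner_Integration.integral_sum) auto
  also have "\<dots> = (\<Sum>n<N. ?D n h + (?D (Suc n) h - ?D n h)) / real N"
    using g h by (simp add: expectation_displacement_diff)
  also have "\<dots> = (\<Sum>n<N. ?D n h) / real N + (?D N h - ?D 0 h) / real N"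
    by (simp only: sum.distrib sum_lessThan_telescope[of "\<lambda>n. ?D n h"] add_divide_distrib)
  finally show ?thesis by (simp only: sum)
qed

lemma liouville_imp_drift_eq_0:
  assumes sym: "symmetric_measure G \<mu>" and L: "liouville G \<mu>"
  shows "drift G \<rho> \<mu> = 0"
proof -
  obtain r l where r: "strict_mono (r :: nat \<Rightarrow> nat)"
    and lim: "\<And>g. g \<in> carrier G \<Longrightarrow> (\<lambda>n. mean_displacement (r n) g) \<longlonglongrightarrow> l g"
    using pointwise_convergent_subsequence[OF countable_carrier, of mean_displacement \<rho>]
      mean_displacement_bound by blast
  \<comment> \<open>For fixed \<open>g\<close> the difference \<open>u\<close> is bounded and
    harmonic, hence constant; comparing its values at \<open>h\<close> and \<open>\<one>\<close>
    gives additivity.\<close>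
  have hom: "l (g \<otimes> h) = l g + l h" if g: "g \<in> carrier G" and h: "h \<in> carrier G" for g h
  proof -
    define u where "u k = l (g \<otimes> k) - l k" for k
    have bound: "\<bar>u k\<bar> \<le> \<rho> g" if k: "k \<in> carrier G" for k
    proof (rule LIMSEQ_le_const2)
      show "(\<lambda>n. \<bar>mean_displacement (r n) (g \<otimes> k) - mean_displacement (r n) k\<bar>) \<longlonglongrightarrow> \<bar>u k\<bar>"
        unfolding u_def using g k by (intro tendsto_intros lim) auto
    qed (use mean_displacement_diff_bound[OF g k] in auto)
    have mean: "measure_pmf.expectation \<mu> (\<lambda>x. u (k \<otimes> x)) = u k" if k: "k \<in> carrier G" for k
    proof (rule LIMSEQ_unique)
      let ?U = "\<lambda>n k. mean_displacement (r n) (g \<otimes> k) - mean_displacement (r n) k"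
      show "(\<lambda>n. measure_pmf.expectation \<mu> (\<lambda>x. ?U n (k \<otimes> x)))
          \<longlonglongrightarrow> measure_pmf.expectation \<mu> (\<lambda>x. u (k \<otimes> x))"
      \<comment> \<open>For fixed \<open>g\<close> the constant \<open>\<rho> g\<close> dominates
        all differences, so the limit commutes with the mean over a step.\<close>
      proof (rule integral_dominated_convergence[where w = "\<lambda>_. \<rho> g"])
        show "AE x in measure_pmf \<mu>. (\<lambda>n. ?U n (k \<otimes> x)) \<longlonglongrightarrow> u (k \<otimes> x)"
          unfolding u_def AE_measure_pmf_iff using g k
          by (intro ballI tendsto_intros lim) (auto dest: in_step)
        show "AE x in measure_pmf \<mu>. norm (?U n (k \<otimes> x)) \<le> \<rho> g" for n
          unfolding AE_measure_pmf_iff using mean_displacement_diff_bound g k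
          by (auto dest: in_step)
      qed auto
      let ?D = "\<lambda>n. displacement n (g \<otimes> k) - displacement n k"
      \<comment> \<open>The boundary term is at most \<open>2 * \<rho> g / real (r n)\<close>, and
        \<open>r n\<close> tends to infinity.\<close>
      have "(\<lambda>n. (?D (r n) - ?D 0) / real (r n)) \<longlonglongrightarrow> 0"
      proof (rule Lim_null_comparison)
        show "\<forall>\<^sub>F n in sequentially. norm ((?D (r n) - ?D 0) / real (r n)) \<le> 2 * \<rho> g / real (r n)"
        proof (intro always_eventually allI)
          fix n
          have "\<bar>?D (r n) - ?D 0\<bar> \<le> 2 * \<rho> g"
            using displacement_diff_bound[OF g k, of "r n"] displacement_diff_bound[OF g k, of 0]
            by linarith
          then show "norm ((?D (r n) - ?D 0) / real (r n)) \<le> 2 * \<rho> g / real (r n)"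
            by (simp add: abs_divide divide_right_mono)
        qed
        have "(\<lambda>n. 2 * \<rho> g / real n) \<longlonglongrightarrow> 0" by real_asymp
        then show "(\<lambda>n. 2 * \<rho> g / real (r n)) \<longlonglongrightarrow> 0"
          using LIMSEQ_subseq_LIMSEQ[OF _ r] by (auto simp: o_def)
      qed
      moreover have "(\<lambda>n. ?U n k) \<longlonglongrightarrow> u k"
        unfolding u_def using g k by (intro tendsto_intros lim) auto
      ultimately have "(\<lambda>n. ?U n k + (?D (r n) - ?D 0) / real (r n)) \<longlonglongrightarrow> u k + 0"
        by (intro tendsto_add)
      then show "(\<lambda>n. measure_pmf.expectation \<mu> (\<lambda>x. ?U n (k \<otimes> x))) \<longlonglongrightarrow> u k"
        using g k by (simp add: expectation_mean_displacement_diff)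
    qed
    have "harmonic G \<mu> u"
      unfolding harmonic_def
    proof
      fix k assume k: "k \<in> carrier G"
      have "integrable (measure_pmf \<mu>) (\<lambda>x. u (k \<otimes> x))"
        using bound k by (intro integrable_pmf_bounded[of _ _ "\<rho> g"]) (auto dest: in_step)
      from has_sum_expectation_pmf[OF support_subset this] mean[OF k]
      show "((\<lambda>s. u (k \<otimes> s) * pmf \<mu> s) has_sum u k) (carrier G)" by simp
    qed
    moreover have "bounded (u ` carrier G)"
      using bound by (auto simp: bounded_iff)
    ultimately obtain c where c: "\<And>k. k \<in> carrier G \<Longrightarrow> u k = c"
      using L unfolding liouville_def by blast
    have "l \<one> = 0"
      using LIMSEQ_unique[OF lim[OF one_closed]] by (simp add: mean_displacement_def displacement_one)
    then show ?thesis using c[OF h] c[OF one_closed] g by (simp add: u_def)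
  qed
  \<comment> \<open>Here the argument ranges over the steps, so the dominating function is
    \<open>\<rho>\<close> itself, which is \<open>\<mu>\<close>-integrable.\<close>
  have "(\<lambda>n. measure_pmf.expectation \<mu> (mean_displacement (r n))) \<longlonglongrightarrow> measure_pmf.expectation \<mu> l"
    using length_integrable mean_displacement_bound lim
    by (intro integral_dominated_convergence[where w = \<rho>]) (auto simp: AE_measure_pmf_iff dest: in_step)
  moreover have "(\<lambda>n. mean_length (r n) / real (r n)) \<longlonglongrightarrow> drift G \<rho> \<mu>"
    using LIMSEQ_subseq_LIMSEQ[OF mean_length_quotient_tendsto_drift r] by (simp add: o_def)
  ultimately have "drift G \<rho> \<mu> = measure_pmf.expectation \<mu> l"
    by (simp add: expectation_mean_displacement LIMSEQ_unique)
  \<comment> \<open>Inversion preserves \<open>\<mu>\<close> and changes the sign of the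
    homomorphism \<open>l\<close>.\<close>
  moreover have "measure_pmf.expectation \<mu> l = - measure_pmf.expectation \<mu> l"
  proof -
    have "measure_pmf.expectation \<mu> l = measure_pmf.expectation \<mu> (\<lambda>x. l (inv x))"
      using integral_map_pmf[of "\<lambda>x. inv x" \<mu> l] map_inv_step[OF sym] by simp
    also have "\<dots> = measure_pmf.expectation \<mu> (\<lambda>x. - l x)"
    proof (rule pmf_expectation_cong)
      fix x assume "x \<in> set_pmf \<mu>"
      then have x: "x \<in> carrier G" by (rule in_step)
      have "l \<one> = 0" using hom[of \<one> \<one>] by simp
      then show "l (inv x) = - l x" using hom[of "inv x" x] x by simp
    qed
    finally show ?thesis by simp
  qed
  ultimately show ?thesis by simp
qed

end

section \<open>Zero drift forces the Liouville property\<close>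

text \<open>The reference law \<open>w\<close> has weights that decay at most exponentially in the
  length; it converts length bounds into entropy bounds.\<close>

locale entropic_length_group = length_group +
  fixes w :: "'a pmf" and c d :: real
  assumes weight_pos: "g \<in> carrier G \<Longrightarrow> 0 < pmf w g"
    and weight_bound: "g \<in> carrier G \<Longrightarrow> - ln (pmf w g) \<le> c * \<rho> g + d"
begin

definition entropy :: "nat \<Rightarrow> real" where
  "entropy n = - measure_pmf.expectation (walk n) (\<lambda>x. ln (pmf (walk n) x))"

text \<open>Compare \<open>walk n\<close> with \<open>w\<close>: the cross entropy is at most the
  mean of \<open>c * \<rho> x + d\<close>.\<close>

lemma entropy_finite: "integrable (measure_pmf (walk n)) (\<lambda>x. ln (pmf (walk n) x))"
  and entropy_le: "entropy n \<le> c * mean_length n + d"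
proof -
  have i: "integrable (measure_pmf (walk n)) (\<lambda>x. c * \<rho> x + d)"
    using integrable_walk_length by simp
  have lw: "integrable (measure_pmf (walk n)) (\<lambda>x. ln (pmf w x))"
  proof (rule integrable_pmf_dominated[OF i])
    fix x assume "x \<in> set_pmf (walk n)"
    then have x: "x \<in> carrier G" by (rule in_walk)
    have "ln (pmf w x) \<le> 0" using weight_pos[OF x] by (simp add: pmf_le_1)
    then show "\<bar>ln (pmf w x)\<bar> \<le> c * \<rho> x + d" using weight_bound[OF x] by simp
  qed
  have sub: "set_pmf (walk n) \<subseteq> set_pmf w"
    using weight_pos by (metis in_walk less_irrefl pmf_eq_0_set_pmf subsetI)
  show "integrable (measure_pmf (walk n)) (\<lambda>x. ln (pmf (walk n) x))"
    by (rule entropy_le_cross_entropy[OF sub lw])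
  have "entropy n \<le> - measure_pmf.expectation (walk n) (\<lambda>x. ln (pmf w x))"
    unfolding entropy_def by (rule entropy_le_cross_entropy[OF sub lw])
  also have "\<dots> = measure_pmf.expectation (walk n) (\<lambda>x. - ln (pmf w x))" by simp
  also have "\<dots> \<le> measure_pmf.expectation (walk n) (\<lambda>x. c * \<rho> x + d)"
    using lw i by (intro pmf_expectation_mono) (auto dest!: in_walk weight_bound)
  also have "\<dots> = c * mean_length n + d"
    using integrable_walk_length by (simp add: mean_length_def)
  finally show "entropy n \<le> c * mean_length n + d" .
qed

text \<open>With \<open>x\<close> the first step and \<open>z\<close> the position at time
  \<open>Suc n\<close>, the joint law \<open>P\<close> has relative entropy
  \<open>entropy (Suc n) - entropy n\<close> with respect to the product \<open>?Q\<close> of its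
  marginals, because given \<open>x\<close> the position \<open>z\<close> is a translate of
  \<open>walk n\<close>. The Gibbs inequality is applied to the test function
  \<open>t * (D x * D z)\<close>: by harmonicity its mean is \<open>t\<close> times that of
  \<open>(D x)\<^sup>2\<close> under \<open>P\<close>, and \<open>0\<close> under
  \<open>?Q\<close>.\<close>

lemma entropy_increment_ge:
  assumes u: "harmonic G \<mu> u" and M: "\<And>g. g \<in> carrier G \<Longrightarrow> \<bar>u g\<bar> \<le> M"
    and g: "g \<in> carrier G" and t: "0 \<le> t" "t * (4 * M\<^sup>2) \<le> 1"
  shows "t * measure_pmf.expectation \<mu> (\<lambda>x. (u (g \<otimes> x) - u g)\<^sup>2) \<le>
    entropy (Suc n) - entropy n + (t * (4 * M\<^sup>2))\<^sup>2"
proof -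
  let ?p = "walk n" and ?q = "walk (Suc n)"
  \<comment> \<open>Since \<open>D\<close> is bounded by \<open>2 * M\<close>, products of two
    values are bounded by \<open>K\<close>; with \<open>t * K \<le> 1\<close> the quadratic bound
    for \<open>exp\<close> applies.\<close>
  define K where "K = 4 * M\<^sup>2"
  define D where "D x = u (g \<otimes> x) - u g" for x
  define T where "T = (\<lambda>(x, y). (x, x \<otimes> y))"
  define f where "f = (\<lambda>(x, z). t * (D x * D z))"
  let ?P' = "pair_pmf \<mu> ?p" and ?Q = "pair_pmf \<mu> ?q"
  define P where "P = map_pmf T ?P'"
  have D: "\<bar>D x\<bar> \<le> 2 * M" if "x \<in> carrier G" for x
    using M[of "g \<otimes> x"] M[of g] g that unfolding D_def by auto
  have f_bound: "\<bar>f (x, z)\<bar> \<le> t * K" if "x \<in> carrier G" "z \<in> carrier G" for x z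
  proof -
    have "\<bar>D x * D z\<bar> \<le> (2 * M) * (2 * M)"
      unfolding abs_mult using D[OF that(1)] D[OF that(2)] by (intro mult_mono) auto
    then show ?thesis using t(1)
      by (simp add: f_def K_def abs_mult power2_eq_square mult_left_mono)
  qed
  have mean_D: "measure_pmf.expectation (walk m) (\<lambda>y. D (x \<otimes> y)) = D x" if "x \<in> carrier G" for m x
  proof -
    have "integrable (measure_pmf (walk m)) (\<lambda>y. u (g \<otimes> (x \<otimes> y)))"
      using M g that by (intro integrable_pmf_bounded[of _ _ M]) (auto dest!: in_walk)
    moreover have "measure_pmf.expectation (walk m) (\<lambda>y. u (g \<otimes> (x \<otimes> y))) =
        measure_pmf.expectation (walk m) (\<lambda>y. u (g \<otimes> x \<otimes> y))"
      using g that by (intro pmf_expectation_cong) (auto dest!: in_walk simp: m_assoc)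
    ultimately show ?thesis
      using expectation_walk_harmonic[OF u M, of "g \<otimes> x" m] g that by (simp add: D_def)
  qed
  have mean_D': "measure_pmf.expectation (walk m) D = 0" for m
  proof -
    have "measure_pmf.expectation (walk m) D = measure_pmf.expectation (walk m) (\<lambda>y. D (\<one> \<otimes> y))"
      by (intro pmf_expectation_cong) (auto dest!: in_walk)
    then show ?thesis using mean_D[of \<one> m] g by (simp add: D_def)
  qed
  \<comment> \<open>Left cancellation makes \<open>T\<close> injective, so \<open>P\<close> gives
    \<open>T z\<close> the product weight of \<open>z\<close>.\<close>
  have inj: "inj_on T (set_pmf ?P')"
    by (auto simp: inj_on_def T_def dest!: in_walk in_step)
  have pmf_P: "pmf P (T z) = pmf \<mu> (fst z) * pmf ?p (snd z)" if "z \<in> set_pmf ?P'" for z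
    using pmf_map_inj[OF inj that] by (cases z) (simp add: P_def pmf_pair)
  have pmf_Q: "pmf ?Q (T z) = pmf \<mu> (fst z) * pmf ?q (case z of (x, y) \<Rightarrow> x \<otimes> y)" for z
    by (cases z) (simp add: T_def pmf_pair)
  have set_P: "set_pmf P \<subseteq> set_pmf ?Q"
    by (auto simp: P_def T_def)
  \<comment> \<open>The law \<open>\<mu>\<close> is \<open>walk 1\<close>, so its entropy is finite;
    this term occurs in both logarithmic integrals and cancels.\<close>
  have l\<mu>: "integrable (measure_pmf ?P') (\<lambda>z. ln (pmf \<mu> (fst z)))"
  proof (rule integrable_pair_pmf_fst)
    have "walk 1 = map_pmf (\<lambda>x. x \<otimes> \<one>) \<mu>"
      by (simp add: pair_return_pmf2 map_pmf_comp)
    also have "\<dots> = map_pmf (\<lambda>x. x) \<mu>" by (intro map_pmf_cong) (auto dest!: in_step)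
    finally have "walk 1 = \<mu>" by (simp add: map_pmf_ident)
    then show "integrable (measure_pmf \<mu>) (\<lambda>x. ln (pmf \<mu> x))" using entropy_finite[of 1] by simp
  qed
  have lp: "integrable (measure_pmf ?P') (\<lambda>z. ln (pmf ?p (snd z)))"
    by (intro integrable_pair_pmf_snd entropy_finite)
  have lq: "integrable (measure_pmf ?P') (\<lambda>z. ln (pmf ?q (case z of (x, y) \<Rightarrow> x \<otimes> y)))"
    using entropy_finite[of "Suc n"] by simp
  have ln_P: "ln (pmf P (T z)) = ln (pmf \<mu> (fst z)) + ln (pmf ?p (snd z))"
    if "z \<in> set_pmf ?P'" for z
    using that unfolding pmf_P[OF that] by (intro ln_mult_pos) (auto simp: pmf_positive)
  have ln_Q: "ln (pmf ?Q (T z)) = ln (pmf \<mu> (fst z)) + ln (pmf ?q (case z of (x, y) \<Rightarrow> x \<otimes> y))"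
    if "z \<in> set_pmf ?P'" for z
    unfolding pmf_Q
  proof (rule ln_mult_pos)
    show "0 < pmf \<mu> (fst z)" using that by (auto simp: pmf_positive)
    have "(case z of (x, y) \<Rightarrow> x \<otimes> y) \<in> set_pmf ?q" using that by force
    then show "0 < pmf ?q (case z of (x, y) \<Rightarrow> x \<otimes> y)" by (rule pmf_positive)
  qed
  have int_P: "integrable (measure_pmf P) (\<lambda>z. ln (pmf P z))"
  proof -
    have "integrable (measure_pmf ?P') (\<lambda>z. ln (pmf P (T z))) \<longleftrightarrow>
        integrable (measure_pmf ?P') (\<lambda>z. ln (pmf \<mu> (fst z)) + ln (pmf ?p (snd z)))"
      using ln_P by (intro integrable_cong_AE) (auto simp: AE_measure_pmf_iff)
    then show ?thesis using l\<mu> lp by (simp add: P_def)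
  qed
  have int_Q: "integrable (measure_pmf P) (\<lambda>z. ln (pmf ?Q z))"
  proof -
    have "integrable (measure_pmf ?P') (\<lambda>z. ln (pmf ?Q (T z))) \<longleftrightarrow>
        integrable (measure_pmf ?P')
          (\<lambda>z. ln (pmf \<mu> (fst z)) + ln (pmf ?q (case z of (x, y) \<Rightarrow> x \<otimes> y)))"
      using ln_Q by (intro integrable_cong_AE) (auto simp: AE_measure_pmf_iff)
    then show ?thesis using l\<mu> lq by (simp add: P_def del: walk.simps)
  qed
  have int_f: "integrable (measure_pmf R) f" if R: "set_pmf R \<subseteq> carrier G \<times> carrier G" for R
  proof (rule integrable_pmf_bounded[of _ _ "t * K"])
    fix z assume "z \<in> set_pmf R"
    then obtain x y where "z = (x, y)" "x \<in> carrier G" "y \<in> carrier G" using R by blast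
    then show "\<bar>f z\<bar> \<le> t * K" using f_bound by simp
  qed
  have in_Q: "set_pmf ?Q \<subseteq> carrier G \<times> carrier G"
    using support_subset set_walk[of "Suc n"] by (auto simp del: walk.simps)
  have f_exp: "exp (f z) \<le> 1 + f z + (t * K)\<^sup>2" if "z \<in> set_pmf ?Q" for z
  proof -
    have "z \<in> carrier G \<times> carrier G" using in_Q that by blast
    then obtain x y where z: "z = (x, y)" "x \<in> carrier G" "y \<in> carrier G" by blast
    have b: "\<bar>f z\<bar> \<le> t * K" using f_bound z by simp
    then have "exp (f z) \<le> 1 + f z + (f z)\<^sup>2"
      using t(2) by (intro exp_le_quadratic) (simp add: K_def)
    moreover have "(f z)\<^sup>2 \<le> (t * K)\<^sup>2" using b by (simp add: abs_le_square_iff[symmetric])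
    ultimately show ?thesis by simp
  qed
  have int_exp: "integrable (measure_pmf ?Q) (\<lambda>z. exp (f z))"
  proof (rule integrable_pmf_dominated)
    show "integrable (measure_pmf ?Q) (\<lambda>z. 1 + f z + (t * K)\<^sup>2)"
      using int_f[OF in_Q] by simp
  qed (use f_exp in auto)
  have "measure_pmf.expectation P f + measure_pmf.expectation P (\<lambda>z. ln (pmf ?Q z)) -
      measure_pmf.expectation P (\<lambda>z. ln (pmf P z)) \<le> measure_pmf.expectation ?Q (\<lambda>z. exp (f z)) - 1"
    using set_P int_f int_P int_Q int_exp in_Q
    by (intro gibbs_variational_inequality) auto
  moreover have "measure_pmf.expectation P f = t * measure_pmf.expectation \<mu> (\<lambda>x. (D x)\<^sup>2)"
  proof -
    have "integrable (measure_pmf P) f" using int_f set_P in_Q by blast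
    then have "measure_pmf.expectation P f =
        measure_pmf.expectation \<mu> (\<lambda>x. measure_pmf.expectation ?p (\<lambda>y. f (x, x \<otimes> y)))"
      unfolding P_def by (simp add: expectation_pair_pmf T_def)
    also have "\<dots> = measure_pmf.expectation \<mu> (\<lambda>x. t * (D x)\<^sup>2)"
      using mean_D by (intro pmf_expectation_cong) (auto simp: f_def power2_eq_square dest!: in_step)
    finally show ?thesis by simp
  qed
  moreover have "measure_pmf.expectation P (\<lambda>z. ln (pmf P z)) =
      measure_pmf.expectation ?P' (\<lambda>z. ln (pmf \<mu> (fst z))) - entropy n"
  proof -
    have "measure_pmf.expectation P (\<lambda>z. ln (pmf P z)) =
        measure_pmf.expectation ?P' (\<lambda>z. ln (pmf \<mu> (fst z)) + ln (pmf ?p (snd z)))"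
      unfolding P_def integral_map_pmf using ln_P by (intro pmf_expectation_cong) (simp add: P_def)
    moreover have "measure_pmf.expectation ?P' (\<lambda>z. ln (pmf ?p (snd z))) = - entropy n"
      using expectation_pair_pmf_snd[of \<mu> ?p "\<lambda>y. ln (pmf ?p y)"] by (simp add: entropy_def)
    ultimately show ?thesis using l\<mu> lp by simp
  qed
  moreover have "measure_pmf.expectation P (\<lambda>z. ln (pmf ?Q z)) =
      measure_pmf.expectation ?P' (\<lambda>z. ln (pmf \<mu> (fst z))) - entropy (Suc n)"
  proof -
    have "measure_pmf.expectation P (\<lambda>z. ln (pmf ?Q z)) = measure_pmf.expectation ?P'
        (\<lambda>z. ln (pmf \<mu> (fst z)) + ln (pmf ?q (case z of (x, y) \<Rightarrow> x \<otimes> y)))"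
      unfolding P_def integral_map_pmf using ln_Q by (intro pmf_expectation_cong) simp
    then show ?thesis using l\<mu> lq by (simp add: entropy_def)
  qed
  \<comment> \<open>Under the product law the linear term vanishes, because \<open>D\<close> has
    mean zero under \<open>?q\<close>; only the quadratic error remains.\<close>
  moreover have "measure_pmf.expectation ?Q (\<lambda>z. exp (f z)) \<le> 1 + (t * K)\<^sup>2"
  proof -
    have "measure_pmf.expectation ?Q f =
        measure_pmf.expectation \<mu> (\<lambda>x. measure_pmf.expectation ?q (\<lambda>y. f (x, y)))"
      by (intro expectation_pair_pmf int_f in_Q)
    also have "\<dots> = 0" using mean_D'[of "Suc n"] by (simp add: f_def del: walk.simps)
    finally have "measure_pmf.expectation ?Q f = 0" .
    moreover have "measure_pmf.expectation ?Q (\<lambda>z. exp (f z)) \<le>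
        measure_pmf.expectation ?Q (\<lambda>z. 1 + f z + (t * K)\<^sup>2)"
      using int_exp int_f[OF in_Q] f_exp by (intro pmf_expectation_mono) auto
    ultimately show ?thesis using int_f[OF in_Q] by simp
  qed
  ultimately show ?thesis by (simp add: D_def K_def)
qed

text \<open>Summing the increment bound over the times below \<open>n\<close> and dividing by
  \<open>n\<close> leaves \<open>t * V \<le> (t * K)\<^sup>2\<close> in the limit, as the entropy
  grows sublinearly. Dividing by \<open>t\<close> and letting \<open>t\<close> tend to zero gives
  \<open>V = 0\<close>, so \<open>u\<close> does not change along a step.\<close>

lemma drift_eq_0_imp_liouville:
  assumes drift: "drift G \<rho> \<mu> = 0"
  shows "liouville G \<mu>"
  unfolding liouville_def
proof (intro allI impI)
  fix u :: "'a \<Rightarrow> real"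
  assume "bounded (u ` carrier G) \<and> harmonic G \<mu> u"
  then obtain M where u: "harmonic G \<mu> u" and M: "\<And>g. g \<in> carrier G \<Longrightarrow> \<bar>u g\<bar> \<le> M"
    by (auto simp: bounded_iff)
  define K where "K = 4 * M\<^sup>2"
  have K: "K \<ge> 0" by (simp add: K_def)
  have step: "u (g \<otimes> x) = u g" if g: "g \<in> carrier G" and x: "x \<in> set_pmf \<mu>" for g x
  proof -
    define V where "V = measure_pmf.expectation \<mu> (\<lambda>x. (u (g \<otimes> x) - u g)\<^sup>2)"
    have tV: "t * V \<le> (t * K)\<^sup>2" if t: "t > 0" "t * K \<le> 1" for t
    proof (rule LIMSEQ_le_const)
      have "(\<lambda>n. c * (mean_length n / real n) + (d - entropy 0) / real n + (t * K)\<^sup>2) \<longlonglongrightarrow>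
          c * drift G \<rho> \<mu> + 0 + (t * K)\<^sup>2"
      proof (intro tendsto_add tendsto_mult tendsto_const mean_length_quotient_tendsto_drift)
        show "(\<lambda>n. (d - entropy 0) / real n) \<longlonglongrightarrow> 0" by real_asymp
      qed
      then show "(\<lambda>n. c * (mean_length n / real n) + (d - entropy 0) / real n + (t * K)\<^sup>2) \<longlonglongrightarrow>
          (t * K)\<^sup>2" by (simp add: drift)
      have "t * V \<le> c * (mean_length n / real n) + (d - entropy 0) / real n + (t * K)\<^sup>2"
        if n: "n \<ge> 1" for n
      proof -
        have "(\<Sum>k<n. t * V) \<le> (\<Sum>k<n. (entropy (Suc k) - entropy k) + (t * K)\<^sup>2)"
          unfolding V_def K_def using t
          by (intro sum_mono entropy_increment_ge[OF u M g]) (auto simp: K_def)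
        also have "\<dots> = entropy n - entropy 0 + real n * (t * K)\<^sup>2"
          by (simp add: sum.distrib sum_lessThan_telescope)
        also have "\<dots> \<le> c * mean_length n + d - entropy 0 + real n * (t * K)\<^sup>2"
          using entropy_le[of n] by simp
        also have "\<dots> = real n *
            (c * (mean_length n / real n) + (d - entropy 0) / real n + (t * K)\<^sup>2)"
          using n by (simp add: distrib_left)
        finally show ?thesis using n by simp
      qed
      then show "\<exists>N. \<forall>n\<ge>N. t * V \<le>
          c * (mean_length n / real n) + (d - entropy 0) / real n + (t * K)\<^sup>2" by blast
    qed
    have "V \<le> 0"
    proof (rule field_le_epsilon)
      fix e :: real assume e: "e > 0"
      \<comment> \<open>The first entry ensures \<open>t * K \<le> 1\<close>, the second
        \<open>t * K\<^sup>2 \<le> e\<close>; adding \<open>1\<close> keeps the denominators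
        positive when \<open>K = 0\<close>.\<close>
      define t where "t = min (1 / (K + 1)) (e / (K\<^sup>2 + 1))"
      have t: "t > 0" using K e by (simp add: t_def add_nonneg_pos)
      have "t * K \<le> (1 / (K + 1)) * K" using K by (intro mult_right_mono) (auto simp: t_def)
      also have "\<dots> \<le> 1" using K by simp
      finally have "t * V \<le> (t * K)\<^sup>2" using tV t by blast
      then have "t * V \<le> t * (t * K\<^sup>2)" by (simp add: power2_eq_square mult_ac)
      then have "V \<le> t * K\<^sup>2" using t by simp
      also have "\<dots> \<le> (e / (K\<^sup>2 + 1)) * K\<^sup>2" by (intro mult_right_mono) (auto simp: t_def)
      also have "\<dots> \<le> e"
      proof -
        have "0 < K\<^sup>2 + 1" by (simp add: add_nonneg_pos)
        then show ?thesis using e by (simp add: pos_divide_le_eq distrib_left)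
      qed
      finally show "V \<le> 0 + e" by simp
    qed
    have i: "integrable (measure_pmf \<mu>) (\<lambda>x. (u (g \<otimes> x) - u g)\<^sup>2)"
    proof (rule integrable_pmf_bounded[of _ _ "(2 * M)\<^sup>2"])
      fix x assume "x \<in> set_pmf \<mu>"
      then have "\<bar>u (g \<otimes> x) - u g\<bar> \<le> 2 * M" using M[of "g \<otimes> x"] M[of g] g in_step by fastforce
      then show "\<bar>(u (g \<otimes> x) - u g)\<^sup>2\<bar> \<le> (2 * M)\<^sup>2"
        using power_mono[of "\<bar>u (g \<otimes> x) - u g\<bar>" "2 * M" 2] by simp
    qed
    have "V \<ge> 0" unfolding V_def by (intro integral_nonneg_AE) simp
    with \<open>V \<le> 0\<close> have "V = 0" by simp
    then have "AE x in measure_pmf \<mu>. (u (g \<otimes> x) - u g)\<^sup>2 = 0"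
      using integral_nonneg_eq_0_iff_AE[OF i] by (simp add: V_def)
    then show ?thesis using x by (simp add: AE_measure_pmf_iff)
  qed
  \<comment> \<open>Invariance under single steps extends to products, and the support generates the
    group as a semigroup, so every element is reached from \<open>\<one>\<close>.\<close>
  have "u (g \<otimes> h) = u g" if "h \<in> semigroup_generate G (set_pmf \<mu>)" "g \<in> carrier G" for g h
    using that
  proof (induction arbitrary: g)
    case (incl h)
    then show ?case using step by blast
  next
    case (mult h k)
    then have "h \<in> carrier G" "k \<in> carrier G" using support_generates by auto
    then show ?case using mult by (simp add: m_assoc[symmetric])
  qed
  then have "u h = u \<one>" if "h \<in> carrier G" for h
    using that support_generates by (metis l_one one_closed)
  then show "\<exists>c. \<forall>g\<in>carrier G. u g = c" by blast
qed

end

section \<open>Word norms\<close>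

context group
begin

lemma list_mult_closed: "set xs \<subseteq> carrier G \<Longrightarrow> list_mult G xs \<in> carrier G"
  by (induction xs) (auto simp: list_mult_def)

lemma list_mult_append:
  "\<lbrakk>set xs \<subseteq> carrier G; set ys \<subseteq> carrier G\<rbrakk> \<Longrightarrow>
    list_mult G (xs @ ys) = list_mult G xs \<otimes> list_mult G ys"
proof (induction xs)
  case Nil
  then show ?case using list_mult_closed[of ys] by (simp add: list_mult_def)
next
  case (Cons x xs)
  then show ?case
    using list_mult_closed[of xs] list_mult_closed[of ys]
    by (auto simp: list_mult_def m_assoc)
qed

lemma inv_list_mult:
  "set xs \<subseteq> carrier G \<Longrightarrow> inv (list_mult G xs) = list_mult G (rev (map (\<lambda>x. inv x) xs))"
proof (induction xs)
  case Nil
  then show ?case by (simp add: list_mult_def)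
next
  case (Cons x xs)
  have "list_mult G (rev (map (\<lambda>x. inv x) (x # xs))) =
      list_mult G (rev (map (\<lambda>x. inv x) xs)) \<otimes> list_mult G [inv x]"
    using Cons.prems by (simp, intro list_mult_append) auto
  also have "\<dots> = inv (list_mult G xs) \<otimes> inv x"
    using Cons by (simp add: list_mult_def)
  also have "\<dots> = inv (list_mult G (x # xs))"
    using Cons.prems list_mult_closed[of xs] by (simp add: list_mult_def inv_mult_group)
  finally show ?case by simp
qed

lemma set_power_mult:
  assumes "S \<subseteq> carrier G" "g \<in> set_power G S m" "h \<in> set_power G S n"
  shows "g \<otimes> h \<in> set_power G S (m + n)"
proof -
  obtain xs ys where "g = list_mult G xs" "length xs = m" "set xs \<subseteq> S"
    and "h = list_mult G ys" "length ys = n" "set ys \<subseteq> S"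
    using assms(2,3) by (auto simp: set_power_def)
  then show ?thesis
    using assms(1) list_mult_append[of xs ys]
    by (auto simp: set_power_def intro!: exI[of _ "xs @ ys"])
qed

lemma set_power_inv:
  assumes "S \<subseteq> carrier G" "m_inv G ` S \<subseteq> S" "g \<in> set_power G S n"
  shows "inv g \<in> set_power G S n"
proof -
  obtain xs where xs: "g = list_mult G xs" "length xs = n" "set xs \<subseteq> S"
    using assms(3) by (auto simp: set_power_def)
  then have "inv g = list_mult G (rev (map (\<lambda>x. inv x) xs))"
    using assms(1) inv_list_mult[of xs] by auto
  moreover have "set (rev (map (\<lambda>x. inv x) xs)) \<subseteq> S" using xs(3) assms(2) by auto
  ultimately show ?thesis
    using xs(2) unfolding set_power_def by fastforce
qed

lemma set_power_0: "set_power G S 0 = {\<one>}"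
  by (auto simp: set_power_def list_mult_def)

text \<open>Since \<open>S\<close> is closed under inversion, the inverse of a generator is again a
  one-letter word, so products of letters exhaust the generated subgroup.\<close>

lemma generate_imp_set_power:
  assumes S: "S \<subseteq> carrier G" "m_inv G ` S \<subseteq> S" and g: "g \<in> generate G S"
  shows "\<exists>n. g \<in> set_power G S n"
proof -
  have one: "s \<in> set_power G S 1" if "s \<in> S" for s
    using that S(1) by (auto simp: set_power_def list_mult_def intro!: exI[of _ "[s]"])
  show ?thesis using g
  proof induction
    case one
    then show ?case by (auto simp: set_power_0 intro!: exI[of _ 0])
  next
    case (eng h1 h2)
    then show ?case using set_power_mult[OF S(1)] by blast
  qed (use one S(2) in blast)+
qed

text \<open>The identity has norm \<open>0\<close> by convention; for other elements the exponent
  \<open>0\<close> is impossible, so \<open>n\<close> belongs to the set whose infimum is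
  taken.\<close>

lemma word_norm_of_le:
  assumes "g \<in> set_power G S n"
  shows "word_norm_of G S g \<le> n"
proof (cases "g = \<one>")
  case False
  then have "n \<noteq> 0" using assms by (cases "n = 0") (auto simp: set_power_0)
  then show ?thesis
    using False assms by (auto simp: word_norm_of_def intro!: cInf_lower)
qed (simp add: word_norm_of_def)

text \<open>An infimum of natural numbers is attained once the set is nonempty, which the hypothesis
  guarantees away from the identity.\<close>

lemma set_power_word_norm_of:
  assumes "g \<in> set_power G S n"
  shows "g \<in> set_power G S (word_norm_of G S g)"
proof (cases "g = \<one>")
  case True
  then show ?thesis by (simp add: word_norm_of_def set_power_0)
next
  case False
  then have "n \<noteq> 0" using assms by (cases "n = 0") (auto simp: set_power_0)
  then have "n \<in> {n. n \<ge> 1 \<and> g \<in> set_power G S n}" using assms by simp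
  then have "{n. n \<ge> 1 \<and> g \<in> set_power G S n} \<noteq> {}" by blast
  from Inf_nat_def1[OF this] show ?thesis using False by (simp add: word_norm_of_def)
qed

end

text \<open>\<open>w\<close> is the law of the product of a random word with geometric length and
  uniform letters. A shortest word for \<open>g\<close>, of length \<open>n\<close>, already
  contributes \<open>(1 / 2) ^ (n + 1) * (1 / N) ^ n\<close>, whose logarithm is affine in
  \<open>n\<close>.\<close>

lemma (in group) exponential_weight:
  assumes S: "finite S" "S \<subseteq> carrier G" "m_inv G ` S \<subseteq> S" "generate G S = carrier G"
  obtains w :: "'a pmf" and c d :: real
  where "\<And>g. g \<in> carrier G \<Longrightarrow> 0 < pmf w g"
    and "\<And>g. g \<in> carrier G \<Longrightarrow> - ln (pmf w g) \<le> c * real (word_norm_of G S g) + d"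
proof -
  \<comment> \<open>Adding the identity keeps the alphabet nonempty even if \<open>S\<close> is
    empty, as the uniform law requires.\<close>
  define T where "T = insert \<one> S"
  define N where "N = real (card T)"
  define w where "w = bind_pmf (geometric_pmf (1 / 2))
    (\<lambda>n. map_pmf (list_mult G) (replicate_pmf n (pmf_of_set T)))"
  have T: "finite T" "T \<noteq> {}" using S by (auto simp: T_def)
  then have N: "N > 0" by (simp add: N_def card_gt_0_iff)
  have w: "0 < pmf w g \<and>
      - ln (pmf w g) \<le> (ln 2 + ln N) * real (word_norm_of G S g) + ln 2"
    if g: "g \<in> carrier G" for g
  proof -
    define n where "n = word_norm_of G S g"
    obtain m where "g \<in> set_power G S m"
      using generate_imp_set_power[OF S(2,3)] g S(4) by blast
    then have "g \<in> set_power G S n" unfolding n_def by (rule set_power_word_norm_of)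
    then obtain xs where xs: "g = list_mult G xs" "length xs = n" "set xs \<subseteq> S"
      by (auto simp: set_power_def)
    define e where "e = (1 / 2) ^ n * (1 / 2) * (1 / N) ^ n"
    have e: "e > 0" using N by (simp add: e_def)
    have "prod_list (map (pmf (pmf_of_set T)) xs) = (1 / N) ^ length xs"
      using xs(3) T
    proof (induction xs)
      case (Cons x xs)
      then show ?case by (simp add: T_def N_def)
    qed simp
    then have "(1 / N) ^ n = pmf (replicate_pmf n (pmf_of_set T)) xs"
      using xs(2) by (simp add: pmf_replicate_pmf)
    also have "\<dots> \<le> pmf (map_pmf (list_mult G) (replicate_pmf n (pmf_of_set T))) g"
      unfolding xs(1) by (rule pmf_map_ge)
    finally have "e \<le> pmf (geometric_pmf (1 / 2)) n *
        pmf (map_pmf (list_mult G) (replicate_pmf n (pmf_of_set T))) g"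
      by (simp add: e_def)
    also have "\<dots> \<le> pmf w g" unfolding w_def by (rule pmf_bind_ge)
    finally have le: "e \<le> pmf w g" .
    then have "ln e \<le> ln (pmf w g)" using e by simp
    moreover have "ln e = - ((ln 2 + ln N) * real n + ln 2)"
      using N by (simp add: e_def ln_mult ln_div ln_realpow algebra_simps)
    ultimately show ?thesis using e le by (simp add: n_def)
  qed
  then show ?thesis using that[of w "ln 2 + ln N" "ln 2"] by blast
qed

theorem theorem2p1:
  fixes G :: "('a, 'b) monoid_scheme" and \<mu> :: "'a pmf" and \<rho> :: "'a \<Rightarrow> real"
  assumes "measured_group G \<mu>"
    and "finitely_generated G"
    and "symmetric_measure G \<mu>"
    and "word_norm G \<rho>"
    and "measure_integrable G \<mu> \<rho>"
  shows "liouville G \<mu> \<longleftrightarrow> drift G \<rho> \<mu> = 0"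
proof -
  interpret measured_group G \<mu> by fact
  obtain S where S: "finite S" "S \<subseteq> carrier G" "generate G S = carrier G" "m_inv G ` S = S"
    and \<rho>: "\<And>s. s \<in> carrier G \<Longrightarrow> \<rho> s = real (word_norm_of G S s)"
    using assms(4) by (auto simp: word_norm_def)
  have power: "g \<in> set_power G S (word_norm_of G S g)" if "g \<in> carrier G" for g
    using generate_imp_set_power[of S g] that S set_power_word_norm_of by blast
  have inv_le: "word_norm_of G S (inv\<^bsub>G\<^esub> g) \<le> word_norm_of G S g" if "g \<in> carrier G" for g
    using power[OF that] S by (intro word_norm_of_le set_power_inv) auto
  obtain w c d where w: "\<And>g. g \<in> carrier G \<Longrightarrow> 0 < pmf w g"
    and wc: "\<And>g. g \<in> carrier G \<Longrightarrow> - ln (pmf w g) \<le> c * real (word_norm_of G S g) + d"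
    using exponential_weight[of S] S by blast
  \<comment> \<open>Concatenating shortest words gives subadditivity, \<open>inv_le\<close> at
    \<open>g\<close> and at its inverse gives symmetry, and summability over the carrier is
    integrability because the carrier contains the support.\<close>
  interpret entropic_length_group G \<mu> \<rho> w c d
  proof unfold_locales
    show "\<rho> \<one>\<^bsub>G\<^esub> = 0" by (simp add: \<rho> word_norm_of_def)
    show "0 \<le> \<rho> g" if "g \<in> carrier G" for g using that by (simp add: \<rho>)
    show "\<rho> (g \<otimes>\<^bsub>G\<^esub> h) \<le> \<rho> g + \<rho> h" if "g \<in> carrier G" "h \<in> carrier G" for g h
      using word_norm_of_le[OF set_power_mult[OF S(2) power power], of g h] that
      by (simp add: \<rho> flip: of_nat_add)
    show "\<rho> (inv\<^bsub>G\<^esub> g) = \<rho> g" if "g \<in> carrier G" for g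
      using inv_le[of g] inv_le[of "inv\<^bsub>G\<^esub> g"] that by (simp add: \<rho>)
    show "integrable (measure_pmf \<mu>) \<rho>"
      using assms(5) integrable_pmf_iff_summable_on[OF support_subset]
      by (simp add: measure_integrable_def)
  qed (use w wc \<rho> in auto)
  show ?thesis
    using liouville_imp_drift_eq_0[OF assms(3)] drift_eq_0_imp_liouville by blast
qed

end
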